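(* Let $K$ be a simplicial complex on vertex set $[n]=\{1,\ldots,n\}$ without ghost vertices. If the moment-angle complex $(D^2,S^1)^K$ is a co-$H$-space, then for every pair of disjoint non-empty subsets $I,J\subsetneq[n]$ the suspended inclusion $$\Sigma^{|I\cup J|+1}\iota_{I,J}\colon \Sigma^{|I\cup J|+1}|K_{I\cup J}|\longrightarrow \Sigma^{|I\cup J|+1}|K_I\ast K_J|$$ is nullhomotopic.
   Context: A simplicial complex $K$ on $[n]$ has no ghost vertices if $\{i\}\in K$ for every $i\in[n]$. The moment-angle complex is $(D^2,S^1)^K=\bigcup_{\sigma\in K}Y_1^\sigma\times\cdots\times Y_n^\sigma\subseteq (D^2)^{\times n}$, where $Y_i^\sigma=D^2$ if $i\in\sigma$ and $Y_i^\sigma=S^1$ if $i\notin\sigma$. For $I\subseteq[n]$, $K_I$ is the restriction (full subcomplex) of $K$ to vertex set $I$; $|\cdot|$ is geometric realisation; $K_I\ast K_J$ is the simplicial join; and $\iota_{I,J}\colon|K_{I\cup J}|\to|K_I\ast K_J|$ is the map induced by the canonical inclusion of simplicial complexes $K_{I\cup J}\to K_I\ast K_J$. Realisations $|K|$ are regarded as having no basepoint, so the first suspension is the unreduced suspension, which is then based at the cone point corresponding to $-1\in[-1,1]$; further suspensions are reduced. In the introduction the conclusion is called the "homotopy Golod" condition on $K$. *)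

theory Defs
  imports "HOL-Analysis.Analysis"
begin

subsection \<open>Abstract simplicial complexes\<close>

definition simplicial_complex_on :: "'v set \<Rightarrow> 'v set set \<Rightarrow> bool" where
  "simplicial_complex_on V K \<longleftrightarrow>
     K \<subseteq> Pow V \<and> {} \<in> K \<and> (\<forall>\<sigma>\<in>K. \<forall>\<tau>. \<tau> \<subseteq> \<sigma> \<longrightarrow> \<tau> \<in> K)"

definition no_ghost_vertices :: "'v set \<Rightarrow> 'v set set \<Rightarrow> bool" where
  "no_ghost_vertices V K \<longleftrightarrow> (\<forall>v\<in>V. {v} \<in> K)"

definition full_subcomplex :: "'v set set \<Rightarrow> 'v set \<Rightarrow> 'v set set" where
  "full_subcomplex K I = {\<sigma> \<in> K. \<sigma> \<subseteq> I}"

text \<open>The join is only meaningful for complexes on disjoint vertex sets.\<close>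

definition simplicial_join :: "'v set set \<Rightarrow> 'v set set \<Rightarrow> 'v set set" where
  "simplicial_join K L = {\<sigma> \<union> \<tau> | \<sigma> \<tau>. \<sigma> \<in> K \<and> \<tau> \<in> L}"


subsection \<open>Geometric realisation\<close>

text \<open>
  Points are given by their barycentric coordinates.  The topology is that of pointwise
  convergence of the coordinates, which is the usual one for a complex with finitely many vertices.
\<close>

definition realization :: "'v set set \<Rightarrow> ('v \<Rightarrow> real) topology" where
  "realization K = subtopology (powertop_real UNIV)
     {x. (\<forall>v. 0 \<le> x v) \<and> {v. x v \<noteq> 0} \<in> K \<and> (\<Sum>v | x v \<noteq> 0. x v) = 1}"

text \<open>The map of realisations induced by a simplicial map, the latter being given on vertices.\<close>

definition realization_map :: "('v \<Rightarrow> 'w) \<Rightarrow> ('v \<Rightarrow> real) \<Rightarrow> ('w \<Rightarrow> real)" where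
  "realization_map f x = (\<lambda>w. \<Sum>v | x v \<noteq> 0 \<and> f v = w. x v)"

lemma realization_map_id: "realization_map id x = x"
proof
  fix w
  have "{v. x v \<noteq> 0 \<and> id v = w} = (if x w = 0 then {} else {w})" by auto
  then show "realization_map id x w = x w"
    by (simp add: realization_map_def)
qed


subsection \<open>The moment-angle complex\<close>

definition moment_angle_complex :: "nat \<Rightarrow> nat set set \<Rightarrow> (nat \<Rightarrow> complex) topology" where
  "moment_angle_complex n K =
     subtopology (product_topology (\<lambda>i. euclidean) {1..n})
       (\<Union>\<sigma>\<in>K. \<Pi>\<^sub>E i\<in>{1..n}. if i \<in> \<sigma> then cball 0 1 else sphere 0 1)"

text \<open>
  The basepoint \<open>(1,\<dots>,1)\<close>.  The choice of a point of the torus \<open>(S\<^sup>1)\<^sup>n\<close> is immaterial, since the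
  torus acts on the moment-angle complex by homeomorphisms.
\<close>

definition moment_angle_base :: "nat \<Rightarrow> nat \<Rightarrow> complex" where
  "moment_angle_base n = (\<lambda>i\<in>{1..n}. 1)"


subsection \<open>Pointed homotopy and co-H-spaces\<close>

definition pointed_map :: "'a topology \<Rightarrow> 'a \<Rightarrow> 'b topology \<Rightarrow> 'b \<Rightarrow> ('a \<Rightarrow> 'b) \<Rightarrow> bool" where
  "pointed_map X a Y b f \<longleftrightarrow> continuous_map X Y f \<and> f a = b"

definition pointed_homotopic ::
    "'a topology \<Rightarrow> 'a \<Rightarrow> 'b topology \<Rightarrow> 'b \<Rightarrow> ('a \<Rightarrow> 'b) \<Rightarrow> ('a \<Rightarrow> 'b) \<Rightarrow> bool" where
  "pointed_homotopic X a Y b = homotopic_with (\<lambda>h. h a = b) X Y"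

definition nullhomotopic ::
    "'a topology \<Rightarrow> 'a \<Rightarrow> 'b topology \<Rightarrow> 'b \<Rightarrow> ('a \<Rightarrow> 'b) \<Rightarrow> bool" where
  "nullhomotopic X a Y b f \<longleftrightarrow> pointed_homotopic X a Y b f (\<lambda>x. b)"

text \<open>
  The wedge of pointed spaces, realised as the subspace of the product consisting of the two axes.
  The two pinch maps onto the wedge summands are then the two projections.
\<close>

definition wedge :: "'a topology \<Rightarrow> 'a \<Rightarrow> 'b topology \<Rightarrow> 'b \<Rightarrow> ('a \<times> 'b) topology" where
  "wedge X a Y b = subtopology (prod_topology X Y) {(x, y). x = a \<or> y = b}"

definition co_H_space :: "'a topology \<Rightarrow> 'a \<Rightarrow> bool" where
  "co_H_space X a \<longleftrightarrow> a \<in> topspace X \<and>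
     (\<exists>\<psi>. pointed_map X a (wedge X a X a) (a, a) \<psi> \<and>
          pointed_homotopic X a X a (fst \<circ> \<psi>) id \<and>
          pointed_homotopic X a X a (snd \<circ> \<psi>) id)"


subsection \<open>Suspensions\<close>

definition quotient_topology :: "'a topology \<Rightarrow> ('a \<Rightarrow> 'b) \<Rightarrow> 'b topology" where
  "quotient_topology X q = topology (\<lambda>U. U \<subseteq> q ` topspace X \<and> openin X {x \<in> topspace X. q x \<in> U})"

lemma openin_quotient_topology:
  "openin (quotient_topology X q) U \<longleftrightarrow>
     U \<subseteq> q ` topspace X \<and> openin X {x \<in> topspace X. q x \<in> U}"
proof -
  have "istopology (\<lambda>U. U \<subseteq> q ` topspace X \<and> openin X {x \<in> topspace X. q x \<in> U})"
    unfolding istopology_def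
  proof (intro conjI allI impI)
    fix S T
    assume S: "S \<subseteq> q ` topspace X \<and> openin X {x \<in> topspace X. q x \<in> S}"
      and T: "T \<subseteq> q ` topspace X \<and> openin X {x \<in> topspace X. q x \<in> T}"
    then show "S \<inter> T \<subseteq> q ` topspace X" by blast
    have "{x \<in> topspace X. q x \<in> S \<inter> T} =
        {x \<in> topspace X. q x \<in> S} \<inter> {x \<in> topspace X. q x \<in> T}" by blast
    then show "openin X {x \<in> topspace X. q x \<in> S \<inter> T}"
      using S T by (simp add: openin_Int)
  next
    fix \<U>
    assume U: "\<forall>U\<in>\<U>. U \<subseteq> q ` topspace X \<and> openin X {x \<in> topspace X. q x \<in> U}"
    then show "\<Union>\<U> \<subseteq> q ` topspace X" by blast
    have "{x \<in> topspace X. q x \<in> \<Union>\<U>} = (\<Union>U\<in>\<U>. {x \<in> topspace X. q x \<in> U})" by blast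
    moreover have "openin X (\<Union>U\<in>\<U>. {x \<in> topspace X. q x \<in> U})"
      by (rule openin_Union) (use U in blast)
    ultimately show "openin X {x \<in> topspace X. q x \<in> \<Union>\<U>}" by simp
  qed
  then show ?thesis
    by (simp add: quotient_topology_def)
qed

lemma topspace_quotient_topology: "topspace (quotient_topology X q) = q ` topspace X"
proof
  show "topspace (quotient_topology X q) \<subseteq> q ` topspace X"
    using openin_topspace[of "quotient_topology X q"]
    unfolding openin_quotient_topology by (rule conjunct1)
  have "{x \<in> topspace X. q x \<in> q ` topspace X} = topspace X" by blast
  then have "openin (quotient_topology X q) (q ` topspace X)"
    by (simp add: openin_quotient_topology)
  then show "q ` topspace X \<subseteq> topspace (quotient_topology X q)"
    by (rule openin_subset)
qed

lemma quotient_map_quotient_topology: "quotient_map X (quotient_topology X q) q"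
  by (simp add: quotient_map_def topspace_quotient_topology openin_quotient_topology)

text \<open>
  Points of iterated suspensions.  \<open>South\<close> and \<open>North\<close> are the cone points at \<open>-1\<close> and \<open>1\<close>,
  \<open>Mer x t\<close> with \<open>-1 < t < 1\<close> is the class of \<open>(x, t)\<close> in the first suspension, and \<open>Mer' p t\<close>
  with \<open>-1 < t < 1\<close> and \<open>p\<close> not the basepoint is the class of \<open>(p, t)\<close> in a later suspension.
  All these suspensions are based at \<open>South\<close>: the basepoint of the first one is the
  cone point at \<open>-1\<close>, and \<open>South\<close> is reused to denote the basepoint of each later one.
\<close>

datatype 'a susp_point = South | North | Mer 'a real | Mer' "'a susp_point" real

definition unreduced_class :: "'a \<Rightarrow> real \<Rightarrow> 'a susp_point" where
  "unreduced_class x t = (if t = -1 then South else if t = 1 then North else Mer x t)"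

text \<open>
  Only used for non-empty spaces (for the empty space this definition does not include the cone
  points).
\<close>

definition unreduced_suspension :: "'a topology \<Rightarrow> 'a susp_point topology" where
  "unreduced_suspension X =
     quotient_topology (prod_topology X (top_of_set {-1..1})) (\<lambda>(x, t). unreduced_class x t)"

fun unreduced_suspension_map :: "('a \<Rightarrow> 'b) \<Rightarrow> 'a susp_point \<Rightarrow> 'b susp_point" where
  "unreduced_suspension_map f North = North"
| "unreduced_suspension_map f (Mer x t) = Mer (f x) t"
| "unreduced_suspension_map f _ = South"

lemma unreduced_suspension_map_class:
  "unreduced_suspension_map f (unreduced_class x t) = unreduced_class (f x) t"
  by (simp add: unreduced_class_def)

text \<open>
  The reduced suspension of a space based at \<open>South\<close> collapses
  \<open>(X \<times> {-1, 1}) \<union> ({South} \<times> [-1, 1])\<close> to a point.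
\<close>

definition reduced_class :: "'a susp_point \<Rightarrow> real \<Rightarrow> 'a susp_point" where
  "reduced_class p t = (if p = South \<or> t = -1 \<or> t = 1 then South else Mer' p t)"

definition reduced_suspension :: "'a susp_point topology \<Rightarrow> 'a susp_point topology" where
  "reduced_suspension X =
     quotient_topology (prod_topology X (top_of_set {-1..1})) (\<lambda>(p, t). reduced_class p t)"

fun reduced_suspension_map ::
    "('a susp_point \<Rightarrow> 'b susp_point) \<Rightarrow> 'a susp_point \<Rightarrow> 'b susp_point" where
  "reduced_suspension_map f (Mer' p t) = reduced_class (f p) t"
| "reduced_suspension_map f _ = South"

lemma reduced_suspension_map_class:
  assumes "f South = South"
  shows "reduced_suspension_map f (reduced_class p t) = reduced_class (f p) t"
  using assms by (simp add: reduced_class_def)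

text \<open>
  The \<open>m\<close>-fold suspension, for \<open>m \<ge> 1\<close>, of a space without basepoint: one unreduced suspension
  followed by \<open>m - 1\<close> reduced ones.
\<close>

definition suspension :: "nat \<Rightarrow> 'a topology \<Rightarrow> 'a susp_point topology" where
  "suspension m X = (reduced_suspension ^^ (m - 1)) (unreduced_suspension X)"

definition suspension_map :: "nat \<Rightarrow> ('a \<Rightarrow> 'b) \<Rightarrow> 'a susp_point \<Rightarrow> 'b susp_point" where
  "suspension_map m f = (reduced_suspension_map ^^ (m - 1)) (unreduced_suspension_map f)"

end

theory Submission
  imports Defs
begin

text \<open>
  Write \<open>Z\<^sub>K\<close> for the moment-angle complex, \<open>V = I \<union> J\<close>, \<open>M = K\<^sub>V\<close>, \<open>L = K\<^sub>I \<ast> K\<^sub>J\<close>, and call the set of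
  points of \<open>Z\<^sub>K\<close> with some coordinate equal to \<open>1\<close> the fat wedge. Writing \<open>D\<^sup>2\<close> as the reduced cone
  on the circle identifies the quotient of \<open>Z\<^sub>L\<close> by its fat wedge with \<open>\<Sigma>\<^bsup>|V|+1\<^esup>|L|\<close>, naturally in the
  complex; let \<open>p\<close> be the quotient map. Since \<open>Z\<^sub>L\<close> is the product of the moment-angle complexes of
  \<open>K\<^sub>I\<close> and \<open>K\<^sub>J\<close>, a comultiplication \<open>\<psi>\<close> on \<open>Z\<^sub>K\<close> deforms \<open>p\<close> on \<open>Z\<^sub>M\<close> to the map that applies \<open>p\<close>
  to the \<open>I\<close>-part of \<open>fst \<circ> \<psi>\<close> and the \<open>J\<close>-part of \<open>snd \<circ> \<psi>\<close>, which is constant because one of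
  the two parts is the basepoint. For this nullhomotopy to descend to \<open>\<Sigma>\<^bsup>|V|+1\<^esup>|M|\<close> it must be constant
  on the fat wedge. This is arranged one coordinate \<open>i\<close> at a time: if \<open>F z\<close> is the path followed by
  \<open>z\<close> and \<open>e z\<close> is \<open>z\<close> with the coordinate \<open>i\<close> set to \<open>1\<close>, then \<open>F (e z)\<close> is a loop, and \<open>F z\<close> is
  replaced by the path \<open>F z\<close> followed by the reverse of \<open>F (e z)\<close>, cut short where \<open>z i\<close> is near \<open>1\<close>.
\<close>

subsection \<open>Quotient maps\<close>

text \<open>Splitting off the coordinate \<open>v\<close> is a homeomorphism onto a binary product,
  and multiplying a quotient map by a locally compact Hausdorff space again gives a quotient map.
  This adds one suspension coordinate at a time.\<close>

lemma quotient_map_product_insert: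
  assumes "v \<notin> V" and f: "quotient_map (prod_topology X (product_topology T V)) Y f"
    and "locally_compact_space (T v)" "Hausdorff_space (T v)"
  shows "quotient_map (prod_topology X (product_topology T (insert v V))) (prod_topology Y (T v))
           (\<lambda>(x, t). (f (x, restrict t V), t v))"
proof -
  let ?r = "\<lambda>(x, t). ((x, restrict t V), t v)"
  let ?s = "\<lambda>((x, t), s). (x, t(v := s))"
  have coord: "continuous_map (product_topology T (insert v V)) (T i) (\<lambda>t. t i)"
    if "i \<in> insert v V" for i
    using that by (rule continuous_map_product_coordinates)
  have "continuous_map (prod_topology X (product_topology T (insert v V)))
          (prod_topology (prod_topology X (product_topology T V)) (T v)) ?r"
    unfolding case_prod_unfold
    by (intro continuous_map_pairedI continuous_map_fst
        continuous_map_compose[OF continuous_map_snd, unfolded o_def])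
      (auto simp: continuous_map_componentwise extensional_def intro: coord)
  moreover have "continuous_map (prod_topology (prod_topology X (product_topology T V)) (T v))
          (prod_topology X (product_topology T (insert v V))) ?s"
    unfolding case_prod_unfold
  proof (intro continuous_map_pairedI)
    let ?P = "prod_topology (prod_topology X (product_topology T V)) (T v)"
    show "continuous_map ?P X (\<lambda>p. fst (fst p))"
      using continuous_map_fst_of[OF continuous_map_fst] by (simp add: o_def)
    have t: "continuous_map ?P (product_topology T V) (\<lambda>p. snd (fst p))"
      using continuous_map_snd_of[OF continuous_map_fst] by (simp add: o_def)
    have "continuous_map ?P (T i) (\<lambda>p. snd (fst p) i)" if "i \<in> V" for i
      using continuous_map_compose[OF t continuous_map_product_coordinates[OF that]]
      by (simp add: o_def)
    then show "continuous_map ?P (product_topology T (insert v V)) (\<lambda>p. (snd (fst p))(v := snd p))"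
      unfolding continuous_map_componentwise
      by (auto simp: extensional_def PiE_def intro: continuous_map_snd
          continuous_map_eq[where f = "\<lambda>p. snd (fst p) _"])
  qed
  ultimately have "retraction_map (prod_topology X (product_topology T (insert v V)))
          (prod_topology (prod_topology X (product_topology T V)) (T v)) ?r"
    unfolding retraction_map_def retraction_maps_def
    using assms(1) by (auto intro!: exI[of _ ?s] simp: restrict_def PiE_def extensional_def fun_eq_iff)
  from quotient_map_compose[OF retraction_imp_quotient_map[OF this]
      quotient_map_prod_left[OF assms(3) _ f]] assms(4)
  show ?thesis by (simp add: o_def case_prod_unfold)
qed

text \<open>A map from a compact space to a Hausdorff space is closed, so \<open>g\<close> descends
  along \<open>f\<close> wherever it is constant on fibres. Collapsing \<open>C\<close> to the
  single value \<open>c\<close> means that surjectivity of \<open>f\<close> and constancy on single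
  fibres have to be checked only off \<open>C\<close>.\<close>

lemma continuous_map_factor_modulo_closed:
  assumes "compact_space X" and Y: "Hausdorff_space Y" and f: "continuous_map X Y f"
    and g: "continuous_map X Z g" and C: "closedin Y C" and c: "c \<in> topspace Z"
    and cover: "\<And>y. y \<in> topspace Y \<Longrightarrow> y \<notin> C \<Longrightarrow> y \<in> f ` topspace X"
    and const: "\<And>x. x \<in> topspace X \<Longrightarrow> f x \<in> C \<Longrightarrow> g x = c"
    and inj: "\<And>x x'. x \<in> topspace X \<Longrightarrow> x' \<in> topspace X \<Longrightarrow> f x = f x' \<Longrightarrow> f x \<notin> C \<Longrightarrow> g x = g x'"
  obtains h where "continuous_map Y Z h" "\<And>x. x \<in> topspace X \<Longrightarrow> h (f x) = g x"
    "\<And>y. y \<in> C \<Longrightarrow> h y = c"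
proof
  define h where "h = (\<lambda>y. if y \<in> C then c else g (SOME x. x \<in> topspace X \<and> f x = y))"
  show hC: "h y = c" if "y \<in> C" for y using that by (simp add: h_def)
  show hf: "h (f x) = g x" if x: "x \<in> topspace X" for x
  proof (cases "f x \<in> C")
    case False
    define x' where "x' = (SOME x'. x' \<in> topspace X \<and> f x' = f x)"
    have "x' \<in> topspace X \<and> f x' = f x"
      unfolding x'_def by (rule someI[of _ x]) (use x in simp)
    with inj[of x x'] x False show ?thesis by (simp add: h_def flip: x'_def)
  qed (simp add: h_def const x)
  have "h y \<in> topspace Z" if y: "y \<in> topspace Y" for y
  proof (cases "y \<in> C")
    case False
    with cover y obtain x where "x \<in> topspace X" "y = f x" by blast
    with hf g show ?thesis by (auto simp: continuous_map_def)
  qed (simp add: h_def c)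
  moreover have "closedin Y {y \<in> topspace Y. h y \<in> D}" if D: "closedin Z D" for D
  proof -
    have "closedin X {x \<in> topspace X. g x \<in> D}"
      using g D by (simp add: continuous_map_closedin)
    then have "closedin Y (f ` {x \<in> topspace X. g x \<in> D})"
      using T1_Spaces.continuous_imp_closed_map[OF f assms(1) Y] by (simp add: closed_map_def)
    \<comment> \<open>Off \<open>C\<close> the preimage is the image of a closed set under the
      closed map \<open>f\<close>; on \<open>C\<close> it is everything or nothing, according to
      whether \<open>c\<close> lies in \<open>D\<close>.\<close>
    moreover have "{y \<in> topspace Y. h y \<in> D} =
        f ` {x \<in> topspace X. g x \<in> D} \<union> (if c \<in> D then C else {})"
    proof (intro equalityI subsetI)
      fix y assume y: "y \<in> {y \<in> topspace Y. h y \<in> D}"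
      show "y \<in> f ` {x \<in> topspace X. g x \<in> D} \<union> (if c \<in> D then C else {})"
      proof (cases "y \<in> C")
        case False
        with cover y obtain x where "x \<in> topspace X" "y = f x" by blast
        with y hf show ?thesis by auto
      qed (use y in \<open>auto simp: h_def\<close>)
    next
      fix y assume "y \<in> f ` {x \<in> topspace X. g x \<in> D} \<union> (if c \<in> D then C else {})"
      then show "y \<in> {y \<in> topspace Y. h y \<in> D}"
        using hf hC f closedin_subset[OF C]
        by (auto simp: continuous_map_def Pi_iff split: if_splits)
    qed
    ultimately show ?thesis using C by auto
  qed
  ultimately show "continuous_map Y Z h" by (auto simp: continuous_map_closedin)
qed


subsection \<open>Iterated suspensions as quotients of cylinders\<close>

text \<open>The composite of all suspension quotient maps: \<open>s\<close> is the coordinate of the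
  unreduced suspension, each \<open>t v\<close> that of a reduced one, and the head of the list
  belongs to the outermost suspension.\<close>

fun suspension_class :: "'v list \<Rightarrow> ('a \<times> real) \<times> ('v \<Rightarrow> real) \<Rightarrow> 'a susp_point" where
  "suspension_class [] ((x, s), t) = unreduced_class x s"
| "suspension_class (v # vs) ((x, s), t) = reduced_class (suspension_class vs ((x, s), t)) (t v)"

definition suspension_cylinder ::
    "'v set \<Rightarrow> 'a topology \<Rightarrow> (('a \<times> real) \<times> ('v \<Rightarrow> real)) topology" where
  "suspension_cylinder V X = prod_topology (prod_topology X (top_of_set {-1..1}))
     (product_topology (\<lambda>_. top_of_set {-1..1}) V)"

lemma suspension_class_cong:
  "(\<And>v. v \<in> set vs \<Longrightarrow> t v = t' v) \<Longrightarrow> suspension_class vs ((x, s), t) = suspension_class vs ((x, s), t')"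
  by (induction vs) auto

lemma quotient_map_suspension_class:
  fixes vs :: "'v list" and X :: "'a topology"
  assumes "distinct vs"
  shows "quotient_map (suspension_cylinder (set vs) X) (suspension (length vs + 1) X) (suspension_class vs)"
  using assms
proof (induction vs)
  case Nil
  \<comment> \<open>The product over the empty index set is a one-point space, so the projection is
    a quotient map.\<close>
  have "quotient_map (suspension_cylinder ({} :: 'v set) X) (prod_topology X (top_of_set {-1..1})) fst"
    unfolding suspension_cylinder_def
    by (simp flip: null_topspace_iff_trivial)
  from quotient_map_compose[OF this quotient_map_quotient_topology[of _ "\<lambda>(x, s). unreduced_class x s"]]
  have "quotient_map (suspension_cylinder ({} :: 'v set) X) (suspension 1 X) ((\<lambda>(x, s). unreduced_class x s) \<circ> fst)"
    by (simp add: suspension_def unreduced_suspension_def)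
  moreover have "(\<lambda>(x, s). unreduced_class x s) \<circ> fst =
      (suspension_class [] :: ('a \<times> real) \<times> ('v \<Rightarrow> real) \<Rightarrow> 'a susp_point)"
    by (auto simp: fun_eq_iff)
  ultimately show ?case by simp
next
  case (Cons v vs)
  let ?I = "top_of_set {-1..1::real}"
  have "quotient_map (suspension_cylinder (set (v # vs)) X)
      (prod_topology (suspension (length vs + 1) X) ?I)
      (\<lambda>(x, t). (suspension_class vs (x, restrict t (set vs)), t v))"
    using Cons unfolding suspension_cylinder_def list.set
    by (intro quotient_map_product_insert)
      (auto intro!: compact_imp_locally_compact_space Hausdorff_space_subtopology
        simp: compact_space_subtopology compactin_euclidean_iff)
  from quotient_map_compose[OF this quotient_map_quotient_topology[of _ "\<lambda>(p, t). reduced_class p t"]]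
  have "quotient_map (suspension_cylinder (set (v # vs)) X) (suspension (length (v # vs) + 1) X)
     ((\<lambda>(p, t). reduced_class p t) \<circ> (\<lambda>(x, t). (suspension_class vs (x, restrict t (set vs)), t v)))"
    by (simp add: suspension_def reduced_suspension_def)
  moreover have "(\<lambda>(p, t). reduced_class p t) \<circ>
      (\<lambda>(x, t). (suspension_class vs (x, restrict t (set vs)), t v)) =
      (suspension_class (v # vs) :: ('a \<times> real) \<times> ('v \<Rightarrow> real) \<Rightarrow> 'a susp_point)"
    by (auto simp: fun_eq_iff intro!: arg_cong2[where f = reduced_class] suspension_class_cong)
  ultimately show ?case by simp
qed

lemma suspension_map_class:
  "suspension_map (length vs + 1) f (suspension_class vs ((x, s), t)) = suspension_class vs ((f x, s), t)"
proof (induction vs)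
  case (Cons v vs)
  \<comment> \<open>The iterated map preserves the basepoint, as
    \<open>reduced_suspension_map_class\<close> demands.\<close>
  have "(reduced_suspension_map ^^ n) (unreduced_suspension_map f) South = South" for n
    by (cases n) auto
  then show ?case using Cons by (simp add: suspension_map_def reduced_suspension_map_class)
qed (simp add: suspension_map_def unreduced_suspension_map_class)

lemma suspension_class_eq_South_iff:
  "suspension_class vs ((x, s), t) = South \<longleftrightarrow> s = -1 \<or> (\<exists>v\<in>set vs. \<bar>t v\<bar> = 1)"
  by (induction vs) (auto simp: unreduced_class_def reduced_class_def)

text \<open>Away from the basepoint only the cone point \<open>North\<close> of the first suspension
  still identifies points, which is why \<open>x\<close> may be lost when
  \<open>s = 1\<close>.\<close>

lemma suspension_class_eqD:
  assumes "suspension_class vs ((x, s), t) = suspension_class vs ((x', s'), t')"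
    and "suspension_class vs ((x, s), t) \<noteq> South"
  shows "s = s' \<and> (s = 1 \<or> x = x') \<and> (\<forall>v\<in>set vs. t v = t' v)"
  using assms
  by (induction vs) (auto simp: unreduced_class_def reduced_class_def split: if_splits)


subsection \<open>Nullhomotopies on moment-angle complexes\<close>

text \<open>The vertex set is arbitrary, so that full subcomplexes and joins on
  \<open>I \<union> J\<close> are covered without renumbering.\<close>

definition moment_angle :: "'v set \<Rightarrow> 'v set set \<Rightarrow> ('v \<Rightarrow> complex) topology" where
  "moment_angle V K = subtopology (product_topology (\<lambda>i. euclidean) V)
     (\<Union>\<sigma>\<in>K. \<Pi>\<^sub>E i\<in>V. if i \<in> \<sigma> then cball 0 1 else sphere 0 1)"

text \<open>Since \<open>K\<close> is closed under subsets, some simplex contains all non-unimodular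
  coordinates iff these coordinates themselves form a simplex.\<close>

lemma topspace_moment_angle:
  assumes "simplicial_complex_on V K"
  shows "z \<in> topspace (moment_angle V K) \<longleftrightarrow>
    z \<in> extensional V \<and> (\<forall>i\<in>V. norm (z i) \<le> 1) \<and> {i \<in> V. norm (z i) \<noteq> 1} \<in> K"
proof -
  have slot: "w \<in> (if b then cball 0 1 else sphere 0 1) \<longleftrightarrow> norm w \<le> 1 \<and> (norm w \<noteq> 1 \<longrightarrow> b)"
    for w :: complex and b by auto
  have "z \<in> topspace (moment_angle V K) \<longleftrightarrow> (\<exists>\<sigma>\<in>K. z \<in> extensional V \<and>
      (\<forall>i\<in>V. norm (z i) \<le> 1 \<and> (norm (z i) \<noteq> 1 \<longrightarrow> i \<in> \<sigma>)))"
    unfolding moment_angle_def topspace_subtopology topspace_product_topology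
    by (auto simp only: PiE_def Pi_iff slot topspace_euclidean Int_iff UN_iff UNIV_I)
  also have "\<dots> \<longleftrightarrow> z \<in> extensional V \<and> (\<forall>i\<in>V. norm (z i) \<le> 1) \<and>
      (\<exists>\<sigma>\<in>K. {i \<in> V. norm (z i) \<noteq> 1} \<subseteq> \<sigma>)"
    by (simp only: subset_iff mem_Collect_eq) meson
  also have "(\<exists>\<sigma>\<in>K. {i \<in> V. norm (z i) \<noteq> 1} \<subseteq> \<sigma>) \<longleftrightarrow> {i \<in> V. norm (z i) \<noteq> 1} \<in> K"
    using assms by (meson simplicial_complex_on_def order_refl)
  finally show ?thesis .
qed

lemma continuous_map_moment_angle_coord:
  "i \<in> V \<Longrightarrow> continuous_map (moment_angle V K) euclidean (\<lambda>z. z i)"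
  unfolding moment_angle_def
  by (intro continuous_map_from_subtopology continuous_map_product_coordinates)

lemma continuous_map_into_moment_angle:
  assumes "\<And>x. x \<in> topspace X \<Longrightarrow> f x \<in> topspace (moment_angle V K)"
    and "\<And>i. i \<in> V \<Longrightarrow> continuous_map X euclidean (\<lambda>x. f x i)"
  shows "continuous_map X (moment_angle V K) f"
  using assms unfolding moment_angle_def continuous_map_in_subtopology continuous_map_componentwise
  by (auto simp: PiE_def)

lemma Hausdorff_space_moment_angle: "Hausdorff_space (moment_angle V K)"
  unfolding moment_angle_def
  by (intro Hausdorff_space_subtopology) (simp add: Hausdorff_space_product_topology)

text \<open>
  The Moebius transformation \<open>z \<mapsto> (z + a) / (1 + a z)\<close>, \<open>0 \<le> a < 1\<close>, preserves the disc and the circle, fixes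
  \<open>1\<close>, and sends everything but \<open>-1\<close> to \<open>1\<close> as \<open>a \<rightarrow> 1\<close>. The factor \<open>2 - |z - 1|\<close> keeps \<open>a\<close> away
  from \<open>1\<close> near \<open>z = -1\<close>.
\<close>

definition slide :: "real \<Rightarrow> complex \<Rightarrow> complex" where
  "slide \<tau> z = (let a = of_real (\<tau> * min 1 (2 - norm (z - 1))) in (z + a) / (1 + a * z))"

text \<open>For \<open>a\<close> in [0,1] and \<open>z\<close> in the disc the denominator vanishes
  only if \<open>a = 1\<close> and \<open>z = -1\<close>, but at \<open>z = -1\<close> the factor
  \<open>2 - norm (z - 1)\<close> makes \<open>a\<close> zero.\<close>

lemma slide_bounds:
  fixes z :: complex
  assumes "0 \<le> \<tau>" "\<tau> \<le> 1" "norm z \<le> 1"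
  defines "a \<equiv> \<tau> * min 1 (2 - norm (z - 1))"
  shows "0 \<le> a" "a \<le> 1" "1 + of_real a * z \<noteq> 0"
proof -
  have n: "norm (z - 1) \<le> 2"
    using norm_triangle_ineq4[of z 1] assms(3) unfolding norm_one by linarith
  then show a0: "0 \<le> a" using assms(1) by (simp add: a_def)
  have am: "a \<le> min 1 (2 - norm (z - 1))"
    unfolding a_def using assms(1,2) n by (intro mult_left_le_one_le) auto
  then show a1: "a \<le> 1" by simp
  show "1 + of_real a * z \<noteq> 0"
  proof
    assume "1 + of_real a * z = 0"
    then have az: "of_real a * z = -1" by (metis add.inverse_unique minus_unique)
    then have "norm (of_real a * z) = 1" by simp
    then have "a * norm z = 1" using a0 by (simp add: norm_mult)
    moreover have "a * norm z \<le> a" using a0 assms(3) by (simp add: mult_left_le)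
    ultimately have "a = 1" using a1 by linarith
    with az have "z = -1" by simp
    with am \<open>a = 1\<close> show False by simp
  qed
qed

text \<open>Both parts follow from the identity \<open>key\<close>, whose right-hand side is
  non-negative on the disc and zero on the circle.\<close>

lemma norm_moebius:
  fixes z :: complex and a :: real
  assumes "0 \<le> a" "a \<le> 1" "1 + of_real a * z \<noteq> 0"
  shows "norm z \<le> 1 \<Longrightarrow> norm ((z + of_real a) / (1 + of_real a * z)) \<le> 1"
    and "norm z = 1 \<Longrightarrow> norm ((z + of_real a) / (1 + of_real a * z)) = 1"
proof -
  have key: "(norm (1 + of_real a * z))\<^sup>2 - (norm (z + of_real a))\<^sup>2 = (1 - a\<^sup>2) * (1 - (norm z)\<^sup>2)"
  proof -
    have "(norm (1 + of_real a * z))\<^sup>2 = (1 + a * Re z)\<^sup>2 + (a * Im z)\<^sup>2"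
      "(norm (z + of_real a))\<^sup>2 = (Re z + a)\<^sup>2 + (Im z)\<^sup>2"
      "(norm z)\<^sup>2 = (Re z)\<^sup>2 + (Im z)\<^sup>2"
      by (simp_all only: cmod_power2) simp_all
    then show ?thesis by (simp only:) (simp add: power2_eq_square algebra_simps)
  qed
  have pos: "norm (1 + of_real a * z) > 0" using assms(3) by simp
  { assume "norm z \<le> 1"
    then have "0 \<le> (1 - a\<^sup>2) * (1 - (norm z)\<^sup>2)"
      using assms(1,2) by (intro mult_nonneg_nonneg) (auto simp: power_le_one)
    then have "norm (z + of_real a) \<le> norm (1 + of_real a * z)"
      using key by (intro power2_le_imp_le[OF _ norm_ge_zero]) linarith
    then show "norm ((z + of_real a) / (1 + of_real a * z)) \<le> 1"
      using pos by (simp add: norm_divide) }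
  { assume "norm z = 1"
    then have "(norm (z + of_real a))\<^sup>2 = (norm (1 + of_real a * z))\<^sup>2"
      using key by simp
    then have "norm (z + of_real a) = norm (1 + of_real a * z)"
      by (rule power2_eq_imp_eq) auto
    then show "norm ((z + of_real a) / (1 + of_real a * z)) = 1"
      using pos by (simp add: norm_divide) }
qed

lemma norm_slide:
  assumes "0 \<le> \<tau>" "\<tau> \<le> 1"
  shows "norm z \<le> 1 \<Longrightarrow> norm (slide \<tau> z) \<le> 1"
    and "norm z = 1 \<Longrightarrow> norm (slide \<tau> z) = 1"
  using norm_moebius[OF slide_bounds[OF assms]] by (auto simp: slide_def Let_def)

lemma slide_0 [simp]: "slide 0 z = z"
  by (simp add: slide_def)

lemma slide_at_1: "0 \<le> \<tau> \<Longrightarrow> slide \<tau> 1 = 1"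
proof -
  assume "0 \<le> \<tau>"
  then have "complex_of_real (1 + \<tau>) \<noteq> 0" by (subst of_real_eq_0_iff) simp
  then show ?thesis by (simp add: slide_def)
qed

text \<open>In this range the minimum is 1, so \<open>a = 1\<close> and the numerator equals the
  denominator.\<close>

lemma slide_1:
  assumes "norm z \<le> 1" "norm (z - 1) \<le> 1"
  shows "slide 1 z = 1"
  using slide_bounds(3)[of 1 z] assms by (simp add: slide_def min_def add.commute split: if_splits)

lemma continuous_map_slide:
  assumes "continuous_map X euclideanreal f" "continuous_map X euclidean g"
    and "\<And>x. x \<in> topspace X \<Longrightarrow> 0 \<le> f x \<and> f x \<le> 1 \<and> norm (g x) \<le> 1"
  shows "continuous_map X euclidean (\<lambda>x. slide (f x) (g x))"
  using assms(1,2) slide_bounds(3) assms(3)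
  unfolding continuous_map_atin slide_def Let_def limitin_canonical_iff
  by (intro ballI tendsto_intros) auto

text \<open>The new value never enlarges the set of non-unimodular coordinates.\<close>

lemma moment_angle_fun_upd:
  assumes K: "simplicial_complex_on V K" and z: "z \<in> topspace (moment_angle V K)" and i: "i \<in> V"
    and w: "norm w \<le> 1" "norm (z i) = 1 \<Longrightarrow> norm w = 1"
  shows "z(i := w) \<in> topspace (moment_angle V K)"
proof -
  have "{j \<in> V. norm ((z(i := w)) j) \<noteq> 1} \<subseteq> {j \<in> V. norm (z j) \<noteq> 1}"
    using w by auto
  with z K have "{j \<in> V. norm ((z(i := w)) j) \<noteq> 1} \<in> K"
    unfolding topspace_moment_angle[OF K] simplicial_complex_on_def by blast
  moreover have "z(i := w) \<in> extensional V" "\<forall>j\<in>V. norm ((z(i := w)) j) \<le> 1"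
    using z i w(1) by (auto simp: topspace_moment_angle[OF K] extensional_def)
  ultimately show ?thesis by (simp only: topspace_moment_angle[OF K])
qed

text \<open>
  With \<open>s z = min 1 |z i - 1|\<close> and \<open>e z = z(i := 1)\<close> the new nullhomotopy runs from \<open>P z\<close> to \<open>F (s z, z)\<close>,
  slides to \<open>F (s z, e z)\<close>, and returns to \<open>F (0, e z) = c\<close>. Where the slide does not reach \<open>e z\<close>, we have
  \<open>s z = 1\<close>, and both values are \<open>c\<close> anyway.
\<close>

lemma homotopic_to_const_insert_coordinate:
  assumes K: "simplicial_complex_on V K" and i: "i \<in> V"
    and P: "\<And>z. z \<in> topspace (moment_angle V K) \<Longrightarrow> z i = 1 \<Longrightarrow> P z = c"
    and hom: "homotopic_with
      (\<lambda>h. \<forall>z\<in>topspace (moment_angle V K). (\<exists>j\<in>U. z j = 1) \<longrightarrow> h z = c)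
      (moment_angle V K) W P (\<lambda>_. c)"
  shows "homotopic_with
      (\<lambda>h. \<forall>z\<in>topspace (moment_angle V K). (\<exists>j\<in>insert i U. z j = 1) \<longrightarrow> h z = c)
      (moment_angle V K) W P (\<lambda>_. c)"
proof -
  let ?Z = "moment_angle V K" and ?I = "top_of_set {0..1::real}"
  define \<Phi> where "\<Phi> = (\<lambda>h. \<forall>z\<in>topspace ?Z. (\<exists>j\<in>insert i U. z j = 1) \<longrightarrow> h z = c)"
  obtain F where F: "continuous_map (prod_topology ?I ?Z) W F"
    and F0: "\<And>z. F (0, z) = P z" and F1: "\<And>z. F (1, z) = c"
    and FU: "\<And>t z j. \<lbrakk>0 \<le> t; t \<le> 1; z \<in> topspace ?Z; j \<in> U; z j = 1\<rbrakk> \<Longrightarrow> F (t, z) = c"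
    using hom unfolding homotopic_with_def by fastforce
  define s where "s = (\<lambda>z :: 'a \<Rightarrow> complex. min 1 (norm (z i - 1)))"
  have s01: "0 \<le> s z" "s z \<le> 1" for z by (auto simp: s_def)
  have norm_z: "norm (z i) \<le> 1" if "z \<in> topspace ?Z" for z
    using that i by (simp add: topspace_moment_angle[OF K])
  have comp: "continuous_map X W (\<lambda>x. F (a x, b x))"
    if "continuous_map X euclideanreal a" "\<And>x. x \<in> topspace X \<Longrightarrow> 0 \<le> a x \<and> a x \<le> 1"
      and "continuous_map X ?Z b" for X :: "'c topology" and a b
  proof -
    have "continuous_map X (prod_topology ?I ?Z) (\<lambda>x. (a x, b x))"
      using that by (intro continuous_map_pairedI continuous_map_into_subtopology) auto
    from continuous_map_compose[OF this F] show ?thesis by (simp add: o_def)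
  qed
  let ?X = "prod_topology ?I ?Z"
  have t01: "0 \<le> fst p \<and> fst p \<le> 1 \<and> snd p \<in> topspace ?Z" if "p \<in> topspace ?X" for p
    using that by auto
  have cfst: "continuous_map ?X euclideanreal fst"
    using continuous_map_fst continuous_map_in_subtopology by blast
  have csnd: "continuous_map ?X euclidean (\<lambda>p. snd p j)" if "j \<in> V" for j
    using continuous_map_compose[OF continuous_map_snd continuous_map_moment_angle_coord[OF that]]
    by (simp add: o_def)
  have cs: "continuous_map ?X euclideanreal (\<lambda>p. s (snd p))"
    unfolding s_def using i by (intro continuous_intros csnd)
  have slide_in: "z(i := slide t (z i)) \<in> topspace ?Z" if "z \<in> topspace ?Z" "0 \<le> t" "t \<le> 1" for z t
    using that norm_z by (intro moment_angle_fun_upd[OF K _ i] norm_slide)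
  have one_in: "z(i := 1) \<in> topspace ?Z" if "z \<in> topspace ?Z" for z
    using that by (intro moment_angle_fun_upd[OF K _ i]) auto
  have c_slide: "continuous_map ?X ?Z (\<lambda>p. (snd p)(i := slide (fst p) (snd p i)))"
    using slide_in t01
  proof (intro continuous_map_into_moment_angle)
    fix j assume j: "j \<in> V"
    show "continuous_map ?X euclidean (\<lambda>p. ((snd p)(i := slide (fst p) (snd p i))) j)"
    proof (cases "j = i")
      case True
      then show ?thesis using t01 norm_z csnd[OF i] cfst by (auto intro!: continuous_map_slide)
    qed (use csnd[OF j] in simp)
  qed auto
  have c_one: "continuous_map ?X ?Z (\<lambda>p. (snd p)(i := 1))"
    using one_in t01
  proof (intro continuous_map_into_moment_angle)
    fix j assume j: "j \<in> V"
    show "continuous_map ?X euclidean (\<lambda>p. ((snd p)(i := 1)) j)"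
      using csnd[OF j] by (cases "j = i") auto
  qed auto
  \<comment> \<open>Every stage below has this form. If \<open>z i = 1\<close>, then time 0 turns
    \<open>F\<close> into \<open>P\<close> at a point whose coordinate \<open>i\<close> is still 1;
    if another coordinate in \<open>U\<close> is 1, it is kept by \<open>b\<close> and the
    hypothesis on \<open>F\<close> applies.\<close>
  have \<Phi>I: "\<Phi> (\<lambda>z. F (a z, b z))"
    if "\<And>z. z \<in> topspace ?Z \<Longrightarrow> b z \<in> topspace ?Z" "\<And>z. z \<in> topspace ?Z \<Longrightarrow> 0 \<le> a z \<and> a z \<le> 1"
      "\<And>z. z i = 1 \<Longrightarrow> a z = 0 \<and> b z i = 1" "\<And>z j. z j = 1 \<Longrightarrow> j \<noteq> i \<Longrightarrow> b z j = 1" for a b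
    unfolding \<Phi>_def
  proof (intro ballI impI)
    fix z assume z: "z \<in> topspace ?Z" "\<exists>j\<in>insert i U. z j = 1"
    show "F (a z, b z) = c"
    proof (cases "z i = 1")
      case True
      then show ?thesis using that(1,3)[of z] z(1) by (simp add: F0 P)
    next
      case False
      with z(2) obtain j where "j \<in> U" "z j = 1" "j \<noteq> i" by auto
      then show ?thesis using FU[of "a z" "b z" j] that(1,2,4)[of z] z(1) by simp
    qed
  qed
  have ts: "0 \<le> t * s z \<and> t * s z \<le> 1" if "0 \<le> t" "t \<le> 1" for t z
    using that s01[of z] by (simp add: mult_le_one)
  note [trans] = homotopic_with_trans
  have "homotopic_with \<Phi> ?Z W P (\<lambda>z. F (s z, z))"
    unfolding homotopic_with_def
  proof (intro exI conjI allI ballI)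
    show "continuous_map ?X W (\<lambda>p. F (fst p * s (snd p), snd p))"
      using ts t01 by (intro comp continuous_intros cfst cs) blast
    show "\<Phi> (\<lambda>z. F (fst (t, z) * s (snd (t, z)), snd (t, z)))" if "t \<in> {0..1}" for t
      using ts that by (auto intro!: \<Phi>I simp: s_def)
  qed (simp_all add: F0)
  also have "homotopic_with \<Phi> ?Z W (\<lambda>z. F (s z, z)) (\<lambda>z. F (s z, z(i := slide 1 (z i))))"
    unfolding homotopic_with_def
  proof (intro exI conjI allI ballI)
    show "continuous_map ?X W (\<lambda>p. F (s (snd p), (snd p)(i := slide (fst p) (snd p i))))"
      using s01 by (intro comp cs c_slide) blast
    show "\<Phi> (\<lambda>z. F (s (snd (t, z)), (snd (t, z))(i := slide (fst (t, z)) (snd (t, z) i))))"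
      if "t \<in> {0..1}" for t
      using that s01 slide_in by (auto intro!: \<Phi>I simp: s_def slide_at_1)
  qed simp_all
  also have "homotopic_with \<Phi> ?Z W (\<lambda>z. F (s z, z(i := slide 1 (z i)))) (\<lambda>z. F (s z, z(i := 1)))"
  proof (rule homotopic_with_equal)
    show "continuous_map ?Z W (\<lambda>z. F (s z, z(i := slide 1 (z i))))"
      using calculation homotopic_with_imp_continuous_maps by blast
    show "\<Phi> (\<lambda>z. F (s z, z(i := slide 1 (z i))))"
      using calculation homotopic_with_imp_property by blast
    show "\<Phi> (\<lambda>z. F (s z, z(i := 1)))"
      using s01 one_in by (auto intro!: \<Phi>I simp: s_def)
    show "F (s z, z(i := slide 1 (z i))) = F (s z, z(i := 1))" if "z \<in> topspace ?Z" for z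
    proof (cases "norm (z i - 1) \<le> 1")
      case False
      then show ?thesis by (simp add: s_def F1)
    qed (use norm_z[OF that] in \<open>simp add: slide_1\<close>)
  qed
  also have "homotopic_with \<Phi> ?Z W (\<lambda>z. F (s z, z(i := 1))) (\<lambda>z. P (z(i := 1)))"
    unfolding homotopic_with_def
  proof (intro exI conjI allI ballI)
    show "continuous_map ?X W (\<lambda>p. F ((1 - fst p) * s (snd p), (snd p)(i := 1)))"
      using ts[of "1 - fst _"] t01 by (intro comp continuous_intros cfst cs c_one) force
    show "\<Phi> (\<lambda>z. F ((1 - fst (t, z)) * s (snd (t, z)), (snd (t, z))(i := 1)))" if "t \<in> {0..1}" for t
      using ts[of "1 - t"] that one_in by (auto intro!: \<Phi>I simp: s_def)
  qed (simp_all add: F0)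
  also have "homotopic_with \<Phi> ?Z W (\<lambda>z. P (z(i := 1))) (\<lambda>_. c)"
  proof (rule homotopic_with_equal)
    show "continuous_map ?Z W (\<lambda>z. P (z(i := 1)))"
      using calculation homotopic_with_imp_continuous_maps by blast
    show "\<Phi> (\<lambda>z. P (z(i := 1)))"
      using calculation homotopic_with_imp_property by blast
  qed (use one_in in \<open>auto simp: \<Phi>_def P\<close>)
  finally show ?thesis by (simp add: \<Phi>_def)
qed

text \<open>The given free homotopy is the case of no coordinates; the previous lemma then enlarges
  the set of controlled coordinates one by one up to \<open>V\<close>.\<close>

lemma homotopic_to_const_rel_fat_wedge:
  assumes K: "simplicial_complex_on V K" and "finite V"
    and P: "\<And>z i. \<lbrakk>z \<in> topspace (moment_angle V K); i \<in> V; z i = 1\<rbrakk> \<Longrightarrow> P z = c"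
    and hom: "homotopic_with (\<lambda>_. True) (moment_angle V K) W P (\<lambda>_. c)"
  shows "homotopic_with
      (\<lambda>h. \<forall>z\<in>topspace (moment_angle V K). (\<exists>j\<in>V. z j = 1) \<longrightarrow> h z = c)
      (moment_angle V K) W P (\<lambda>_. c)"
proof -
  have "homotopic_with
      (\<lambda>h. \<forall>z\<in>topspace (moment_angle V K). (\<exists>j\<in>U. z j = 1) \<longrightarrow> h z = c)
      (moment_angle V K) W P (\<lambda>_. c)" if "finite U" "U \<subseteq> V" for U
    using that
  proof (induction U)
    case empty
    then show ?case using hom by simp
  next
    case (insert i U)
    then show ?case using P by (intro homotopic_to_const_insert_coordinate[OF K]) auto
  qed
  with assms(2) show ?thesis by blast
qed


subsection \<open>The moment-angle complex modulo its fat wedge\<close>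

text \<open>The sign places both ends of [-1,1] at the basepoint 1, so this is the quotient map from
  the interval to the pointed circle.\<close>

definition circle_point :: "real \<Rightarrow> complex" where
  "circle_point t = - cis (pi * t)"

text \<open>
  For fixed \<open>y\<close> these points form the circle of radius \<open>1 - y\<close> that touches the unit circle at \<open>1\<close>.
\<close>

definition cone_point :: "complex \<Rightarrow> real \<Rightarrow> complex" where
  "cone_point w y = (1 - of_real y) * w + of_real y"

lemma norm_circle_point [simp]: "norm (circle_point t) = 1"
  by (simp add: circle_point_def)

lemma Arg_cis_pi_mult:
  assumes "-1 < u" "u \<le> 1"
  shows "Arg (cis (pi * u)) = pi * u"
proof (rule Arg_cis)
  have "pi * (-1) < pi * u" "pi * u \<le> pi * 1"
    using assms by (intro mult_strict_left_mono mult_left_mono; simp)+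
  then show "pi * u \<in> {-pi<..pi}" by simp
qed

lemma circle_point_eq_1_iff:
  assumes "-1 \<le> t" "t \<le> 1"
  shows "circle_point t = 1 \<longleftrightarrow> \<bar>t\<bar> = 1"
proof
  assume "circle_point t = 1"
  then have *: "cis (pi * t) = cis pi" by (simp add: circle_point_def minus_equation_iff)
  show "\<bar>t\<bar> = 1"
  proof (cases "t = -1")
    case False
    then have "Arg (cis (pi * t)) = pi * t"
      using assms by (intro Arg_cis_pi_mult) auto
    moreover have "Arg (cis pi) = pi" by (intro Arg_cis) auto
    ultimately show ?thesis using * by simp
  qed simp
next
  assume "\<bar>t\<bar> = 1"
  then have "t = 1 \<or> t = -1" by linarith
  then show "circle_point t = 1" by (auto simp: circle_point_def complex_eq_iff)
qed

lemma circle_point_inj: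
  assumes "\<bar>t\<bar> < 1" "\<bar>t'\<bar> < 1" "circle_point t = circle_point t'"
  shows "t = t'"
proof -
  have "Arg (cis (pi * t)) = Arg (cis (pi * t'))"
    using assms(3) unfolding circle_point_def by (metis minus_minus)
  moreover have "Arg (cis (pi * t)) = pi * t" "Arg (cis (pi * t')) = pi * t'"
    using assms(1,2) by (intro Arg_cis_pi_mult; simp add: abs_less_iff)+
  ultimately show ?thesis by simp
qed

lemma circle_point_surj:
  assumes "norm w = 1"
  obtains t where "-1 \<le> t" "t \<le> 1" "circle_point t = w"
proof
  have b: "-pi < Arg (-w)" "Arg (-w) \<le> pi" using Arg_bounded by auto
  show "-1 \<le> Arg (-w) / pi" "Arg (-w) / pi \<le> 1"
    using b by (simp_all add: pos_le_divide_eq pos_divide_le_eq)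
  have "w \<noteq> 0" using assms by auto
  then show "circle_point (Arg (-w) / pi) = w"
    using assms by (simp add: circle_point_def cis_Arg sgn_div_norm)
qed

text \<open>The right-hand side shows that the cone stays in the disc; since
  \<open>1 - Re (cone_point w y)\<close> is \<open>(1 - y) * (1 - Re w)\<close>, it also allows
  \<open>y\<close> to be recovered from the point.\<close>

lemma norm_cone_point:
  assumes "norm w = 1"
  shows "1 - (norm (cone_point w y))\<^sup>2 = 2 * y * (1 - y) * (1 - Re w)"
proof -
  have w: "(Re w)\<^sup>2 + (Im w)\<^sup>2 = 1" using assms cmod_power2[of w] by simp
  have "(norm (cone_point w y))\<^sup>2 = ((1 - y) * Re w + y)\<^sup>2 + ((1 - y) * Im w)\<^sup>2"
    by (simp add: cmod_power2 cone_point_def)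
  also have "\<dots> = (1 - y)\<^sup>2 * ((Re w)\<^sup>2 + (Im w)\<^sup>2) + 2 * y * (1 - y) * Re w + y\<^sup>2"
    by (simp add: power2_eq_square algebra_simps)
  finally show ?thesis unfolding w by (simp add: power2_eq_square algebra_simps)
qed

lemma cone_point_eq_1_iff: "cone_point w y = 1 \<longleftrightarrow> y = 1 \<or> w = 1"
proof -
  have "cone_point w y - 1 = of_real (1 - y) * (w - 1)"
    by (simp add: cone_point_def algebra_simps)
  then show ?thesis by (metis diff_eq_diff_eq eq_iff_diff_eq_0 mult_eq_0_iff of_real_eq_0_iff)
qed

lemma norm_1_Re_less_1:
  fixes w :: complex
  assumes "norm w \<le> 1" "w \<noteq> 1"
  shows "Re w < 1"
proof -
  have "Re w \<le> 1" using complex_Re_le_cmod[of w] assms(1) by linarith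
  moreover have "Re w \<noteq> 1"
  proof
    assume "Re w = 1"
    moreover have "(Re w)\<^sup>2 + (Im w)\<^sup>2 \<le> 1"
      using power_le_one[OF norm_ge_zero assms(1), of 2] cmod_power2[of w] by linarith
    ultimately have "Im w = 0" by simp
    with \<open>Re w = 1\<close> assms(2) show False by (simp add: complex_eq_iff)
  qed
  ultimately show ?thesis by linarith
qed

lemma norm_cone_point_le:
  assumes "norm w = 1" "0 \<le> y" "y \<le> 1"
  shows "norm (cone_point w y) \<le> 1"
proof -
  have "0 \<le> 1 - Re w" using complex_Re_le_cmod[of w] assms(1) by simp
  then have "0 \<le> 2 * y * (1 - y) * (1 - Re w)" using assms by simp
  then have "(norm (cone_point w y))\<^sup>2 \<le> 1\<^sup>2"
    using norm_cone_point[OF assms(1), of y] by simp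
  then show ?thesis by (rule power2_le_imp_le) simp
qed

text \<open>Away from 1 the height of a point \<open>z\<close> is
  \<open>(1 - (norm z)^2) / (2 * (1 - Re z))\<close>, and the height determines
  \<open>w\<close>.\<close>

lemma cone_point_inj:
  assumes "norm w = 1" "norm w' = 1" "cone_point w y = cone_point w' y'" "cone_point w y \<noteq> 1"
  shows "w = w' \<and> y = y'"
proof -
  have eq: "1 - (norm (cone_point v u))\<^sup>2 = u * (2 * (1 - Re (cone_point v u)))"
    if "norm v = 1" for v u
    using norm_cone_point[OF that, of u] by (simp add: cone_point_def algebra_simps)
  have "(1 - Re (cone_point w y)) = (1 - y) * (1 - Re w)"
    by (simp add: cone_point_def algebra_simps)
  moreover have "Re w < 1" "y \<noteq> 1"
    using norm_1_Re_less_1[of w] assms(1,4) by (auto simp: cone_point_eq_1_iff)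
  ultimately have "1 - Re (cone_point w y) \<noteq> 0" by simp
  with eq[OF assms(1), of y] eq[OF assms(2), of y'] have "y = y'"
    by (simp add: assms(3))
  with assms(3) \<open>y \<noteq> 1\<close> show ?thesis by (simp add: cone_point_def)
qed

lemma cone_point_surj:
  assumes "norm z \<le> 1" "z \<noteq> 1"
  obtains w y where "norm w = 1" "0 \<le> y" "y < 1" "cone_point w y = z"
    "y = 0 \<longleftrightarrow> norm z = 1"
proof
  \<comment> \<open>This is the height formula behind \<open>cone_point_inj\<close>, and
    \<open>w\<close> then solves \<open>cone_point w y = z\<close>. That \<open>y < 1\<close>
    amounts to \<open>(norm (z - 1))^2 > 0\<close>.\<close>
  define y where "y = (1 - (norm z)\<^sup>2) / (2 * (1 - Re z))"
  define w where "w = (z - of_real y) / of_real (1 - y)"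
  have Re: "Re z < 1" using norm_1_Re_less_1 assms by blast
  have z1: "(norm z)\<^sup>2 \<le> 1" using assms(1) by (simp add: power_le_one)
  show "0 \<le> y" using Re z1 by (simp add: y_def)
  have "(norm (z - 1))\<^sup>2 > 0" using assms(2) by simp
  then have "1 - (norm z)\<^sup>2 < 2 * (1 - Re z)"
    unfolding cmod_power2 by (simp add: power2_eq_square algebra_simps)
  then show y1: "y < 1" using Re by (simp add: y_def)
  then have "1 - complex_of_real y \<noteq> 0"
    by (metis of_real_1 of_real_diff of_real_eq_0_iff diff_gt_0_iff_gt less_irrefl)
  then show "cone_point w y = z"
    by (simp add: cone_point_def w_def)
  have y2: "y * (2 * (1 - Re z)) = 1 - (norm z)\<^sup>2" using Re by (simp add: y_def)
  have "(norm (z - of_real y))\<^sup>2 = (norm z)\<^sup>2 - 2 * y * Re z + y\<^sup>2"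
    unfolding cmod_power2 by (simp add: power2_eq_square algebra_simps)
  also have "\<dots> = (1 - y)\<^sup>2" using y2 by (simp add: power2_eq_square algebra_simps)
  finally have "norm (z - of_real y) = 1 - y" using y1 by (auto intro: power2_eq_imp_eq)
  then show "norm w = 1" using y1 unfolding w_def norm_divide norm_of_real by simp
  show "y = 0 \<longleftrightarrow> norm z = 1"
    using Re by (auto simp: y_def power2_eq_1_iff) (metis norm_ge_zero not_one_le_zero neg_0_le_iff_le zero_le_one order_trans)
qed

section \<open>The suspension cylinder mapped to the moment-angle complex\<close>

lemma continuous_map_Max:
  fixes f :: "'i \<Rightarrow> 'a \<Rightarrow> real"
  assumes "finite I" "I \<noteq> {}" "\<And>i. i \<in> I \<Longrightarrow> continuous_map X euclideanreal (f i)"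
  shows "continuous_map X euclideanreal (\<lambda>x. Max ((\<lambda>i. f i x) ` I))"
  using assms
proof (induction I rule: finite_ne_induct)
  case (insert i I)
  then have "continuous_map X euclideanreal (\<lambda>x. max (f i x) (Max ((\<lambda>i. f i x) ` I)))"
    by (intro continuous_intros) auto
  then show ?case using insert by simp
qed simp

text \<open>
  The heights have support in \<open>K\<close> and maximum \<open>(1 - s) / 2\<close>, so that some height is \<open>1\<close> exactly if
  \<open>s = -1\<close>, and all of them vanish exactly if \<open>s = 1\<close>.
\<close>

definition height :: "'v set \<Rightarrow> ('v \<Rightarrow> real) \<Rightarrow> real \<Rightarrow> 'v \<Rightarrow> real" where
  "height V x s i = (1 - s) / 2 * x i / Max (x ` V)"

text \<open>Each \<open>t i\<close> gives the circle direction of coordinate \<open>i\<close>, while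
  \<open>x\<close> and \<open>s\<close>, a point of the cone on the realisation, give the cone
  heights.\<close>

definition cylinder_map :: "'v set \<Rightarrow> (('v \<Rightarrow> real) \<times> real) \<times> ('v \<Rightarrow> real) \<Rightarrow> 'v \<Rightarrow> complex" where
  "cylinder_map V = (\<lambda>((x, s), t). \<lambda>i\<in>V. cone_point (circle_point (t i)) (height V x s i))"

lemma topspace_suspension_cylinder:
  "((x, s), t) \<in> topspace (suspension_cylinder V X) \<longleftrightarrow>
     x \<in> topspace X \<and> -1 \<le> s \<and> s \<le> 1 \<and> t \<in> extensional V \<and> (\<forall>i\<in>V. -1 \<le> t i \<and> t i \<le> 1)"
  by (auto simp: suspension_cylinder_def PiE_def Pi_iff)

context
  fixes V :: "'v set" and K :: "'v set set"
  assumes K: "simplicial_complex_on V K" and fin: "finite V"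
begin

lemma topspace_realization:
  "x \<in> topspace (realization K) \<longleftrightarrow>
     (\<forall>i. 0 \<le> x i) \<and> {i. x i \<noteq> 0} \<in> K \<and> (\<forall>i. i \<notin> V \<longrightarrow> x i = 0) \<and> sum x V = 1"
proof -
  have "sum x {i. x i \<noteq> 0} = sum x V \<and> (\<forall>i. i \<notin> V \<longrightarrow> x i = 0)" if "{i. x i \<noteq> 0} \<in> K"
  proof -
    have "{i. x i \<noteq> 0} \<subseteq> V" using that K by (auto simp: simplicial_complex_on_def)
    then show ?thesis using fin by (auto intro: sum.mono_neutral_left)
  qed
  then show ?thesis unfolding realization_def by auto
qed

lemma realization_Max:
  assumes "x \<in> topspace (realization K)"
  shows "Max (x ` V) > 0" "i \<in> V \<Longrightarrow> x i \<le> Max (x ` V)" "\<exists>i\<in>V. x i = Max (x ` V)"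
proof -
  have x: "\<And>i. 0 \<le> x i" "sum x V = 1" using assms by (auto simp: topspace_realization)
  then have V: "V \<noteq> {}" by auto
  have le: "x j \<le> Max (x ` V)" if "j \<in> V" for j using that fin by simp
  then show "i \<in> V \<Longrightarrow> x i \<le> Max (x ` V)" by blast
  show "Max (x ` V) > 0"
  proof (rule ccontr)
    assume "\<not> ?thesis"
    then have "x i = 0" if "i \<in> V" for i using le[OF that] x(1)[of i] by linarith
    with x(2) show False by simp
  qed
  have "Max (x ` V) \<in> x ` V" using V fin by (intro Max_in) auto
  then show "\<exists>i\<in>V. x i = Max (x ` V)" by force
qed

text \<open>The realisation lies in a compact cube. Its support condition is closed because it says
  that, for each non-face inside \<open>V\<close>, the product of the coordinates over that non-face
  vanishes.\<close>

lemma compact_space_realization: "compact_space (realization K)"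
proof -
  let ?S = "{x :: 'v \<Rightarrow> real. (\<forall>i. 0 \<le> x i) \<and> {i. x i \<noteq> 0} \<in> K \<and> (\<forall>i. i \<notin> V \<longrightarrow> x i = 0) \<and> sum x V = 1}"
  have supp: "{i. x i \<noteq> 0} \<in> K \<longleftrightarrow> (\<forall>\<tau>\<in>{\<tau>. \<tau> \<subseteq> V \<and> \<tau> \<notin> K}. (\<Prod>i\<in>\<tau>. x i) = 0)"
    if "\<forall>i. i \<notin> V \<longrightarrow> x i = 0" for x :: "'v \<Rightarrow> real"
  proof (intro iffI ballI)
    fix \<tau> assume *: "{i. x i \<noteq> 0} \<in> K" "\<tau> \<in> {\<tau>. \<tau> \<subseteq> V \<and> \<tau> \<notin> K}"
    then have "\<not> \<tau> \<subseteq> {i. x i \<noteq> 0}" using K by (auto simp: simplicial_complex_on_def)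
    moreover have "finite \<tau>" using *(2) fin finite_subset by blast
    ultimately show "(\<Prod>i\<in>\<tau>. x i) = 0" by (auto simp: prod_zero_iff)
  next
    assume *: "\<forall>\<tau>\<in>{\<tau>. \<tau> \<subseteq> V \<and> \<tau> \<notin> K}. (\<Prod>i\<in>\<tau>. x i) = 0"
    have "{i. x i \<noteq> 0} \<subseteq> V" using that by auto
    moreover have "(\<Prod>i | x i \<noteq> 0. x i) \<noteq> 0"
      using finite_subset[OF \<open>{i. x i \<noteq> 0} \<subseteq> V\<close> fin] by (simp add: prod_zero_iff)
    ultimately show "{i. x i \<noteq> 0} \<in> K" using * by blast
  qed
  have "?S = {x. \<forall>i. 0 \<le> x i} \<inter> {x. \<forall>i. i \<notin> V \<longrightarrow> x i = 0} \<inter> {x. sum x V = 1} \<inter>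
      {x. \<forall>\<tau>\<in>{\<tau>. \<tau> \<subseteq> V \<and> \<tau> \<notin> K}. (\<Prod>i\<in>\<tau>. x i) = 0}"
  proof (rule set_eqI)
    have conj: "(C \<Longrightarrow> B = E) \<Longrightarrow> (A \<and> B \<and> C \<and> D) = (((A \<and> C) \<and> D) \<and> E)" for A B C D E
      by blast
    show "x \<in> ?S \<longleftrightarrow> x \<in> {x. \<forall>i. 0 \<le> x i} \<inter> {x. \<forall>i. i \<notin> V \<longrightarrow> x i = 0} \<inter>
        {x. sum x V = 1} \<inter> {x. \<forall>\<tau>\<in>{\<tau>. \<tau> \<subseteq> V \<and> \<tau> \<notin> K}. (\<Prod>i\<in>\<tau>. x i) = 0}" for x
      unfolding Int_iff mem_Collect_eq by (rule conj) (rule supp)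
  qed
  moreover have "closed \<dots>"
    unfolding Ball_def
    by (intro closed_Int closed_Collect_all closed_Collect_imp closed_Collect_eq
        closed_Collect_le open_Collect_const continuous_intros
        continuous_on_product_coordinates)
  ultimately have "closedin (powertop_real UNIV) ?S"
    by (simp add: euclidean_product_topology)
  moreover have "?S \<subseteq> (\<Pi>\<^sub>E i\<in>UNIV. {0..1})"
  proof
    fix x assume x: "x \<in> ?S"
    have "x i \<le> 1" for i
    proof (cases "i \<in> V")
      case True
      have "x i \<le> sum x V" using x fin True by (intro member_le_sum) auto
      with x show ?thesis by simp
    qed (use x in auto)
    with x show "x \<in> (\<Pi>\<^sub>E i\<in>UNIV. {0..1})" by auto
  qed
  moreover have "compactin (powertop_real (UNIV :: 'v set)) (\<Pi>\<^sub>E i\<in>UNIV. {0..1})"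
    by (simp add: compactin_PiE compactin_euclidean_iff)
  ultimately have "compactin (powertop_real UNIV) ?S"
    using closed_compactin by blast
  moreover have "realization K = subtopology (powertop_real UNIV) ?S"
  proof -
    have "topspace (realization K) = ?S" using topspace_realization by blast
    then show ?thesis unfolding realization_def by simp
  qed
  ultimately show ?thesis by (simp add: compact_space_subtopology)
qed

lemma compact_space_suspension_cylinder: "compact_space (suspension_cylinder V (realization K))"
  unfolding suspension_cylinder_def
  by (auto simp: compact_space_prod_topology compact_space_realization compact_space_product_topology
      compact_space_subtopology compactin_euclidean_iff)

lemma height_bounds:
  assumes "x \<in> topspace (realization K)" "-1 \<le> s" "s \<le> 1" "i \<in> V"
  shows "0 \<le> height V x s i" "height V x s i \<le> (1 - s) / 2" "height V x s i \<le> 1"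
    "height V x s i \<noteq> 0 \<Longrightarrow> x i \<noteq> 0"
proof -
  note M = realization_Max[OF assms(1)]
  have xi: "0 \<le> x i" using assms(1) by (simp add: topspace_realization)
  show "0 \<le> height V x s i" using xi M(1) assms by (simp add: height_def)
  have "x i / Max (x ` V) \<le> 1" using M(1) M(2)[OF assms(4)] by simp
  then have "(1 - s) / 2 * (x i / Max (x ` V)) \<le> (1 - s) / 2"
    using assms by (intro mult_left_le) auto
  then show "height V x s i \<le> (1 - s) / 2" by (simp add: height_def)
  with assms show "height V x s i \<le> 1" by simp
  show "height V x s i \<noteq> 0 \<Longrightarrow> x i \<noteq> 0" by (auto simp: height_def)
qed

lemma height_attained:
  assumes "x \<in> topspace (realization K)"
  obtains i where "i \<in> V" "height V x s i = (1 - s) / 2"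
proof -
  from realization_Max(1,3)[OF assms] obtain i where i: "i \<in> V" "x i = Max (x ` V)" "Max (x ` V) > 0"
    by blast
  then have "height V x s i = (1 - s) / 2" by (simp add: height_def)
  with i(1) show thesis by (rule that)
qed

lemma continuous_cylinder_map:
  "continuous_map (suspension_cylinder V (realization K)) (moment_angle V K) (cylinder_map V)"
proof (rule continuous_map_into_moment_angle)
  let ?X = "suspension_cylinder V (realization K)"
  show "cylinder_map V a \<in> topspace (moment_angle V K)" if a: "a \<in> topspace ?X" for a
  proof -
    obtain x s t where [simp]: "a = ((x, s), t)" by (metis prod.collapse)
    from a have x: "x \<in> topspace (realization K)" "-1 \<le> s" "s \<le> 1"
      by (auto simp: topspace_suspension_cylinder)
    \<comment> \<open>Height 0 leaves a coordinate on the unit circle, and the heights vanish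
      outside the support of \<open>x\<close>.\<close>
    have "{i \<in> V. norm (cylinder_map V a i) \<noteq> 1} \<subseteq> {i. x i \<noteq> 0}"
    proof safe
      fix i assume i: "i \<in> V" "norm (cylinder_map V a i) \<noteq> 1" "x i = 0"
      then have "height V x s i = 0" by (simp add: height_def)
      with i show False by (simp add: cylinder_map_def cone_point_def)
    qed
    moreover have "{i. x i \<noteq> 0} \<in> K" using x(1) by (simp add: topspace_realization)
    ultimately have "{i \<in> V. norm (cylinder_map V a i) \<noteq> 1} \<in> K"
      using K by (auto simp: simplicial_complex_on_def)
    then show ?thesis
      using height_bounds[OF x] by (auto simp: topspace_moment_angle[OF K] cylinder_map_def norm_cone_point_le)
  qed
  fix i assume i: "i \<in> V"
  have cx: "continuous_map ?X euclideanreal (\<lambda>p. fst (fst p) j)" for j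
  proof -
    have "continuous_map (realization K) euclideanreal (\<lambda>x. x j)"
      unfolding realization_def
      by (intro continuous_map_from_subtopology continuous_map_product_coordinates) simp
    from continuous_map_compose[OF continuous_map_fst_of[OF continuous_map_fst] this]
    show ?thesis by (simp add: suspension_cylinder_def o_def)
  qed
  have cs: "continuous_map ?X euclideanreal (\<lambda>p. snd (fst p))"
    using continuous_map_snd_of[OF continuous_map_fst] continuous_map_in_subtopology
    unfolding suspension_cylinder_def o_def by blast
  have ct: "continuous_map ?X euclideanreal (\<lambda>p. snd p i)"
    using continuous_map_compose[OF continuous_map_snd continuous_map_product_coordinates[OF i]]
      continuous_map_in_subtopology
    unfolding suspension_cylinder_def o_def by blast
  have "Max ((\<lambda>i. fst (fst p) i) ` V) \<noteq> 0" if "p \<in> topspace ?X" for p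
    using that realization_Max(1)[of "fst (fst p)"]
    by (cases p) (auto simp: topspace_suspension_cylinder)
  moreover have "V \<noteq> {}" using i by auto
  ultimately have "continuous_map ?X euclideanreal (\<lambda>p. height V (fst (fst p)) (snd (fst p)) i)"
    unfolding height_def using fin
    by (intro continuous_intros continuous_map_Max cx cs) auto
  with ct have "continuous_map ?X euclidean
      (\<lambda>p. cone_point (circle_point (snd p i)) (height V (fst (fst p)) (snd (fst p)) i))"
    unfolding continuous_map_atin limitin_canonical_iff cone_point_def circle_point_def cis_conv_exp
    by (intro ballI tendsto_intros) auto
  then show "continuous_map ?X euclidean (\<lambda>p. cylinder_map V p i)"
    using i by (simp add: cylinder_map_def case_prod_unfold)
qed

text \<open>The largest height is \<open>(1 - s) / 2\<close>, so height 1 occurs only at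
  \<open>s = -1\<close>. By \<open>suspension_class_eq_South_iff\<close> the fat wedge thus
  corresponds to the basepoint of the suspension.\<close>

lemma cylinder_map_eq_1_iff:
  assumes "((x, s), t) \<in> topspace (suspension_cylinder V (realization K))"
  shows "(\<exists>i\<in>V. cylinder_map V ((x, s), t) i = 1) \<longleftrightarrow> s = -1 \<or> (\<exists>i\<in>V. \<bar>t i\<bar> = 1)"
proof -
  from assms have x: "x \<in> topspace (realization K)" "-1 \<le> s" "s \<le> 1"
    and t: "\<And>i. i \<in> V \<Longrightarrow> -1 \<le> t i \<and> t i \<le> 1"
    by (auto simp: topspace_suspension_cylinder)
  have "(\<exists>i\<in>V. cylinder_map V ((x, s), t) i = 1) \<longleftrightarrow> (\<exists>i\<in>V. height V x s i = 1 \<or> \<bar>t i\<bar> = 1)"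
    using t by (auto simp: cylinder_map_def cone_point_eq_1_iff circle_point_eq_1_iff)
  moreover have "(\<exists>i\<in>V. height V x s i = 1) \<longleftrightarrow> s = -1"
  proof
    assume "\<exists>i\<in>V. height V x s i = 1"
    then show "s = -1" using height_bounds(2)[OF x] x(2) by force
  next
    assume "s = -1"
    then show "\<exists>i\<in>V. height V x s i = 1" using height_attained[OF x(1), of s] by force
  qed
  ultimately show ?thesis by blast
qed

text \<open>The largest height determines \<open>s\<close>, and the heights determine
  \<open>x\<close> up to scale unless all of them vanish, that is, unless
  \<open>s = 1\<close>.\<close>

lemma cylinder_map_inj:
  assumes a: "((x, s), t) \<in> topspace (suspension_cylinder V (realization K))"
    and a': "((x', s'), t') \<in> topspace (suspension_cylinder V (realization K))"
    and eq: "cylinder_map V ((x, s), t) = cylinder_map V ((x', s'), t')"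
    and ne: "\<And>i. i \<in> V \<Longrightarrow> cylinder_map V ((x, s), t) i \<noteq> 1"
  shows "s = s' \<and> (s = 1 \<or> x = x') \<and> (\<forall>i\<in>V. t i = t' i)"
proof -
  from a have x: "x \<in> topspace (realization K)" "-1 \<le> s" "s \<le> 1"
    and t: "\<And>i. i \<in> V \<Longrightarrow> \<bar>t i\<bar> \<le> 1"
    by (auto simp: topspace_suspension_cylinder abs_le_iff minus_le_iff)
  from a' have x': "x' \<in> topspace (realization K)" "-1 \<le> s'" "s' \<le> 1"
    and t': "\<And>i. i \<in> V \<Longrightarrow> \<bar>t' i\<bar> \<le> 1"
    by (auto simp: topspace_suspension_cylinder abs_le_iff minus_le_iff)
  have "circle_point (t i) = circle_point (t' i) \<and> height V x s i = height V x' s' i" if i: "i \<in> V" for i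
    using fun_cong[OF eq, of i] ne[OF i] i by (intro cone_point_inj) (auto simp: cylinder_map_def)
  then have ht: "height V x s i = height V x' s' i" "circle_point (t i) = circle_point (t' i)"
    if "i \<in> V" for i using that by auto
  have "t i = t' i" if i: "i \<in> V" for i
  proof (rule circle_point_inj)
    show "\<bar>t i\<bar> < 1" "\<bar>t' i\<bar> < 1"
      using cylinder_map_eq_1_iff[OF a] cylinder_map_eq_1_iff[OF a'] ne eq i t[OF i] t'[OF i]
      by (force simp: less_le)+
  qed (use ht[OF i] in simp)
  moreover have "s = s'"
  proof -
    obtain i where "i \<in> V" "height V x s i = (1 - s) / 2" using height_attained[OF x(1)] by blast
    moreover obtain j where "j \<in> V" "height V x' s' j = (1 - s') / 2" using height_attained[OF x'(1)] by blast
    ultimately show ?thesis using ht(1) height_bounds(2)[OF x, of j] height_bounds(2)[OF x', of i] by fastforce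
  qed
  moreover have "x = x'" if "s \<noteq> 1"
  proof -
    let ?M = "Max (x ` V)" and ?M' = "Max (x' ` V)"
    have M: "?M > 0" "?M' > 0" using realization_Max(1) x(1) x'(1) by blast+
    have q: "x i / ?M = x' i / ?M'" if "i \<in> V" for i
    proof -
      have "(1 - s) / 2 * (x i / ?M) = (1 - s) / 2 * (x' i / ?M')"
        using ht(1)[OF that] \<open>s = s'\<close> by (simp add: height_def)
      then show ?thesis using \<open>s \<noteq> 1\<close> by (subst (asm) mult_cancel_left) auto
    qed
    \<comment> \<open>The barycentric coordinates sum to 1 on both sides, which fixes the common
      scale.\<close>
    have "sum x V / ?M = sum x' V / ?M'"
      unfolding sum_divide_distrib using q by (intro sum.cong) auto
    then have "?M = ?M'" using x(1) x'(1) M by (simp add: topspace_realization)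
    then have "x i = x' i" if "i \<in> V" for i using q[OF that] M by simp
    moreover have "x i = x' i" if "i \<notin> V" for i
      using x(1) x'(1) that by (simp add: topspace_realization)
    ultimately show ?thesis by blast
  qed
  ultimately show ?thesis by blast
qed

lemma cylinder_map_surj:
  assumes ne: "topspace (realization K) \<noteq> {}" and z: "z \<in> topspace (moment_angle V K)"
    and z1: "\<And>i. i \<in> V \<Longrightarrow> z i \<noteq> 1"
  shows "z \<in> cylinder_map V ` topspace (suspension_cylinder V (realization K))"
proof -
  have z': "z \<in> extensional V" "\<And>i. i \<in> V \<Longrightarrow> norm (z i) \<le> 1" "{i \<in> V. norm (z i) \<noteq> 1} \<in> K"
    using z by (auto simp: topspace_moment_angle[OF K])
  have "\<exists>y t. -1 \<le> t \<and> t \<le> 1 \<and> 0 \<le> y \<and> y < 1 \<and> cone_point (circle_point t) y = z i \<and>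
      (y = 0 \<longleftrightarrow> norm (z i) = 1)" if i: "i \<in> V" for i
  proof -
    obtain w y where w: "norm w = 1" "0 \<le> y" "y < 1" "cone_point w y = z i" "y = 0 \<longleftrightarrow> norm (z i) = 1"
      using cone_point_surj[OF z'(2)[OF i] z1[OF i]] by blast
    moreover obtain t where "-1 \<le> t" "t \<le> 1" "circle_point t = w"
      using circle_point_surj[OF w(1)] by blast
    ultimately show ?thesis by blast
  qed
  then obtain y t where yt: "\<And>i. i \<in> V \<Longrightarrow> -1 \<le> t i \<and> t i \<le> 1 \<and> 0 \<le> y i \<and> y i < 1 \<and>
      cone_point (circle_point (t i)) (y i) = z i \<and> (y i = 0 \<longleftrightarrow> norm (z i) = 1)"
    by metis
  obtain x s where x: "x \<in> topspace (realization K)" "-1 \<le> s" "s \<le> 1"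
    "\<And>i. i \<in> V \<Longrightarrow> height V x s i = y i"
  proof (cases "\<forall>i\<in>V. y i = 0")
    case True
    \<comment> \<open>All heights vanish at \<open>s = 1\<close>, whatever the point of the
      realisation.\<close>
    from ne obtain x where "x \<in> topspace (realization K)" by blast
    with True show thesis by (intro that[of x 1]) (auto simp: height_def)
  next
    case False
    then have V: "V \<noteq> {}" by auto
    define S where "S = sum y V"
    define x where "x = (\<lambda>i. if i \<in> V then y i / S else 0)"
    have S: "S > 0" unfolding S_def
      using False yt fin by (metis sum_nonneg_eq_0_iff sum_nonneg order_less_le)
    have "{i. x i \<noteq> 0} = {i \<in> V. norm (z i) \<noteq> 1}"
      using yt S by (auto simp: x_def)
    moreover have "sum x V = 1"
      using S by (simp add: x_def S_def flip: sum_divide_distrib)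
    moreover have "0 \<le> x i" for i using yt S by (simp add: x_def)
    ultimately have xr: "x \<in> topspace (realization K)"
      using z'(3) by (simp add: topspace_realization x_def)
    have "Max (y ` V) \<in> y ` V" using fin V by simp
    then have m: "0 \<le> Max (y ` V)" "Max (y ` V) < 1" using yt by auto
    have "Max (x ` V) = Max (y ` V) / S"
    proof (rule Max_eqI)
      show "Max (y ` V) / S \<in> x ` V" using \<open>Max (y ` V) \<in> y ` V\<close> by (auto simp: x_def)
    qed (use fin S in \<open>auto simp: x_def divide_right_mono\<close>)
    moreover have "Max (y ` V) \<noteq> 0" using False yt fin by (metis Max_ge finite_imageI image_eqI order_antisym)
    ultimately have "height V x (1 - 2 * Max (y ` V)) i = y i" if "i \<in> V" for i
      using S that by (simp add: height_def x_def)
    then show thesis using xr m by (intro that[of x "1 - 2 * Max (y ` V)"]) auto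
  qed
  have "cylinder_map V ((x, s), restrict t V) = z"
    using z'(1) yt x(4) by (auto simp: cylinder_map_def extensional_def fun_eq_iff)
  moreover have "((x, s), restrict t V) \<in> topspace (suspension_cylinder V (realization K))"
    using x yt by (auto simp: topspace_suspension_cylinder)
  ultimately show ?thesis by force
qed

section \<open>Passing between the fat-wedge quotient and the suspension\<close>

lemma closedin_fat_wedge:
  "closedin (moment_angle V K) {z \<in> topspace (moment_angle V K). \<exists>i\<in>V. z i = 1}"
proof -
  have "closedin (moment_angle V K) {z \<in> topspace (moment_angle V K). z i \<in> {1}}" if "i \<in> V" for i
    using that by (intro closedin_continuous_map_preimage[OF continuous_map_moment_angle_coord]) auto
  then have "closedin (moment_angle V K) (\<Union>i\<in>V. {z \<in> topspace (moment_angle V K). z i \<in> {1}})"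
    using fin by (intro closedin_Union) auto
  moreover have "(\<Union>i\<in>V. {z \<in> topspace (moment_angle V K). z i \<in> {1}}) =
      {z \<in> topspace (moment_angle V K). \<exists>i\<in>V. z i = 1}" by auto
  ultimately show ?thesis by simp
qed

text \<open>The only information that \<open>cylinder_map\<close> loses here is \<open>x\<close> at
  \<open>s = 1\<close>, and the unreduced suspension collapses that to \<open>North\<close> as
  well.\<close>

lemma suspension_class_cong_cylinder:
  assumes vs: "set vs = V"
    and a: "a \<in> topspace (suspension_cylinder V (realization K))"
    and a': "a' \<in> topspace (suspension_cylinder V (realization K))"
    and eq: "cylinder_map V a = cylinder_map V a'"
    and ne: "\<And>i. i \<in> V \<Longrightarrow> cylinder_map V a i \<noteq> 1"
  shows "suspension_class vs a = suspension_class vs a'"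
proof -
  obtain x s t x' s' t' where [simp]: "a = ((x, s), t)" "a' = ((x', s'), t')" by (metis prod.collapse)
  from cylinder_map_inj[of x s t x' s' t'] assms
  have "s = s'" "s = 1 \<or> x = x'" "\<And>i. i \<in> V \<Longrightarrow> t i = t' i" by auto
  then have "suspension_class vs ((x, s), t) = suspension_class vs ((x, s), t')"
    using vs by (intro suspension_class_cong) auto
  also have "\<dots> = suspension_class vs ((x', s'), t')"
  proof (cases "s = 1")
    case True
    have "suspension_class vs ((x, 1), t') = suspension_class vs ((x', 1), t')"
      by (induction vs) (auto simp: unreduced_class_def)
    with True \<open>s = s'\<close> show ?thesis by simp
  qed (use \<open>s = s'\<close> \<open>s = 1 \<or> x = x'\<close> in simp)
  finally show ?thesis by simp
qed

text \<open>The collapse of the fat wedge, followed by the identification with the suspension, is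
  obtained by factoring \<open>suspension_class\<close> through \<open>cylinder_map\<close>.\<close>

lemma moment_angle_to_suspension:
  assumes vs: "distinct vs" "set vs = V" and ne: "topspace (realization K) \<noteq> {}"
  obtains p where "continuous_map (moment_angle V K) (suspension (card V + 1) (realization K)) p"
    "\<And>a. a \<in> topspace (suspension_cylinder V (realization K)) \<Longrightarrow>
        p (cylinder_map V a) = suspension_class vs a"
    "\<And>z i. \<lbrakk>z \<in> topspace (moment_angle V K); i \<in> V; z i = 1\<rbrakk> \<Longrightarrow> p z = South"
proof -
  let ?C = "suspension_cylinder V (realization K)"
  let ?A = "{z \<in> topspace (moment_angle V K). \<exists>i\<in>V. z i = 1}"
  have q: "quotient_map ?C (suspension (card V + 1) (realization K)) (suspension_class vs)"
    using quotient_map_suspension_class[OF vs(1), of "realization K"] vs distinct_card[OF vs(1)] by simp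
  obtain x where x: "x \<in> topspace (realization K)" using ne by blast
  have "((x, -1), \<lambda>i\<in>V. 0) \<in> topspace ?C"
    using x by (simp add: topspace_suspension_cylinder)
  moreover have "suspension_class vs ((x, -1), \<lambda>i\<in>V. 0) = South"
    by (simp add: suspension_class_eq_South_iff)
  ultimately have South: "South \<in> topspace (suspension (card V + 1) (realization K))"
    using quotient_imp_surjective_map[OF q] by (metis image_eqI)
  note thesisI = that
  show thesis
  proof (rule continuous_map_factor_modulo_closed[OF compact_space_suspension_cylinder
        Hausdorff_space_moment_angle continuous_cylinder_map quotient_imp_continuous_map[OF q]
        closedin_fat_wedge South])
    show "z \<in> cylinder_map V ` topspace ?C"
      if "z \<in> topspace (moment_angle V K)" "z \<notin> ?A" for z
      using that by (intro cylinder_map_surj[OF ne]) auto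
    show "suspension_class vs a = South" if "a \<in> topspace ?C" "cylinder_map V a \<in> ?A" for a
    proof -
      obtain x s t where [simp]: "a = ((x, s), t)" by (metis prod.collapse)
      show ?thesis
        using that cylinder_map_eq_1_iff[of x s t] vs(2)
        by (simp add: suspension_class_eq_South_iff)
    qed
    show "suspension_class vs a = suspension_class vs a'"
      if "a \<in> topspace ?C" "a' \<in> topspace ?C" "cylinder_map V a = cylinder_map V a'"
        "cylinder_map V a \<notin> ?A" for a a'
    proof (rule suspension_class_cong_cylinder[OF vs(2) that(1-3)])
      fix i assume "i \<in> V"
      with that show "cylinder_map V a i \<noteq> 1"
        using continuous_cylinder_map by (auto simp: continuous_map_def Pi_iff)
    qed
    show thesis
      if "continuous_map (moment_angle V K) (suspension (card V + 1) (realization K)) p"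
        "\<And>a. a \<in> topspace ?C \<Longrightarrow> p (cylinder_map V a) = suspension_class vs a"
        "\<And>z. z \<in> ?A \<Longrightarrow> p z = South" for p
      by (rule thesisI[OF that(1) that(2) that(3)]) auto
  qed
qed

text \<open>Once the nullhomotopy is constant on the fat wedge, its pullback to the cylinder is
  compatible with \<open>suspension_class\<close> and descends to a pointed nullhomotopy.\<close>

lemma nullhomotopic_suspension_map:
  assumes vs: "distinct vs" "set vs = V" and ne: "topspace (realization K) \<noteq> {}"
    and P1: "\<And>z i. \<lbrakk>z \<in> topspace (moment_angle V K); i \<in> V; z i = 1\<rbrakk> \<Longrightarrow> P z = South"
    and P: "\<And>a. a \<in> topspace (suspension_cylinder V (realization K)) \<Longrightarrow>
        P (cylinder_map V a) = suspension_map (card V + 1) f (suspension_class vs a)"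
    and hom: "homotopic_with (\<lambda>_. True) (moment_angle V K) W P (\<lambda>_. South)"
  shows "nullhomotopic (suspension (card V + 1) (realization K)) South W South
     (suspension_map (card V + 1) f)"
proof -
  let ?C = "suspension_cylinder V (realization K)" and ?S = "suspension (card V + 1) (realization K)"
  let ?I = "top_of_set {0..1::real}"
  have q: "quotient_map ?C ?S (suspension_class vs)"
    using quotient_map_suspension_class[OF vs(1), of "realization K"] vs distinct_card[OF vs(1)] by simp
  have hom': "homotopic_with (\<lambda>h. \<forall>z\<in>topspace (moment_angle V K). (\<exists>j\<in>V. z j = 1) \<longrightarrow> h z = South)
      (moment_angle V K) W P (\<lambda>_. South)"
    by (rule homotopic_to_const_rel_fat_wedge[OF K fin P1 hom])
  obtain F where F: "continuous_map (prod_topology ?I (moment_angle V K)) W F"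
    and F0: "\<And>z. F (0, z) = P z" and F1: "\<And>z. F (1, z) = South"
    and FA: "\<And>t z i. \<lbrakk>0 \<le> t; t \<le> 1; z \<in> topspace (moment_angle V K); i \<in> V; z i = 1\<rbrakk> \<Longrightarrow> F (t, z) = South"
    using hom'
    unfolding homotopic_with_def atLeastAtMost_iff Ball_def Bex_def by blast
  have in_Z: "cylinder_map V a \<in> topspace (moment_angle V K)" if "a \<in> topspace ?C" for a
    using continuous_cylinder_map that by (auto simp: continuous_map_def Pi_iff)
  have South_iff: "suspension_class vs a = South \<longleftrightarrow> (\<exists>i\<in>V. cylinder_map V a i = 1)" if "a \<in> topspace ?C" for a
  proof -
    obtain x s t where [simp]: "a = ((x, s), t)" by (metis prod.collapse)
    show ?thesis using that cylinder_map_eq_1_iff[of x s t] vs(2)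
      by (simp add: suspension_class_eq_South_iff)
  qed
  have G: "continuous_map (prod_topology ?I ?C) W (\<lambda>p. F (fst p, cylinder_map V (snd p)))"
  proof -
    have "continuous_map (prod_topology ?I ?C) (prod_topology ?I (moment_angle V K))
        (\<lambda>p. (fst p, cylinder_map V (snd p)))"
      using continuous_map_compose[OF continuous_map_snd continuous_cylinder_map]
      by (intro continuous_map_pairedI continuous_map_fst) (simp add: o_def)
    from continuous_map_compose[OF this F] show ?thesis by (simp add: o_def)
  qed
  \<comment> \<open>The time interval is compact Hausdorff, so the product with it preserves the
    quotient map and homotopies can be lifted through it.\<close>
  have "quotient_map (prod_topology ?I ?C) (prod_topology ?I ?S) (\<lambda>(t, a). (t, suspension_class vs a))"
    by (intro quotient_map_prod_right q)
      (auto intro!: compact_imp_locally_compact_space Hausdorff_space_subtopology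
        simp: compact_space_subtopology compactin_euclidean_iff)
  then obtain h where h: "continuous_map (prod_topology ?I ?S) W h"
    and hG: "\<And>p. p \<in> topspace (prod_topology ?I ?C) \<Longrightarrow>
        h ((\<lambda>(t, a). (t, suspension_class vs a)) p) = F (fst p, cylinder_map V (snd p))"
  proof (rule quotient_map_lift_exists[OF _ G])
    fix p p' assume p: "p \<in> topspace (prod_topology ?I ?C)" "p' \<in> topspace (prod_topology ?I ?C)"
      and eq: "(\<lambda>(t, a). (t, suspension_class vs a)) p = (\<lambda>(t, a). (t, suspension_class vs a)) p'"
    obtain t a a' where [simp]: "p = (t, a)" "p' = (t, a')"
      using eq by (auto simp: case_prod_unfold prod_eq_iff)
    have a: "0 \<le> t" "t \<le> 1" "a \<in> topspace ?C" "a' \<in> topspace ?C" using p by auto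
    have eq: "suspension_class vs a = suspension_class vs a'" using eq by simp
    have "F (t, cylinder_map V a) = F (t, cylinder_map V a')"
    proof (cases "suspension_class vs a = South")
      case True
      then have "F (t, cylinder_map V a) = South" "F (t, cylinder_map V a') = South"
        using South_iff[OF a(3)] South_iff[OF a(4)] eq FA[OF a(1,2) in_Z[OF a(3)]]
          FA[OF a(1,2) in_Z[OF a(4)]] by auto
      then show ?thesis by simp
    next
      case False
      obtain x s u x' s' u' where [simp]: "a = ((x, s), u)" "a' = ((x', s'), u')" by (metis prod.collapse)
      have "s = s'" "s = 1 \<or> x = x'" "\<And>i. i \<in> V \<Longrightarrow> u i = u' i"
        using suspension_class_eqD[of vs x s u x' s' u'] eq False vs(2) by auto
      \<comment> \<open>If the points of the realisation differ, then \<open>s = 1\<close> and all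
        heights are zero on both sides.\<close>
      then have "cylinder_map V a = cylinder_map V a'"
        by (auto simp: cylinder_map_def height_def fun_eq_iff restrict_def)
      then show ?thesis by simp
    qed
    then show "F (fst p, cylinder_map V (snd p)) = F (fst p', cylinder_map V (snd p'))" by simp
  qed blast
  have ht: "h (t, suspension_class vs a) = F (t, cylinder_map V a)"
    if "0 \<le> t" "t \<le> 1" "a \<in> topspace ?C" for t a
    using hG[of "(t, a)"] that by simp
  have surj: "\<exists>a\<in>topspace ?C. y = suspension_class vs a" if "y \<in> topspace ?S" for y
    using quotient_imp_surjective_map[OF q] that by auto
  obtain x where x: "x \<in> topspace (realization K)" using ne by blast
  have b: "((x, -1), \<lambda>i\<in>V. 0) \<in> topspace ?C"
    using x by (simp add: topspace_suspension_cylinder)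
  have bS: "suspension_class vs ((x, -1), \<lambda>i\<in>V. 0) = South"
    by (simp add: suspension_class_eq_South_iff)
  have South: "South \<in> topspace ?S"
    using quotient_imp_surjective_map[OF q] b bS by (metis image_eqI)
  show ?thesis
    unfolding nullhomotopic_def pointed_homotopic_def
  \<comment> \<open>The values of \<open>h\<close> are known only over the space itself, so the end
    conditions are restricted to its points.\<close>
  proof (subst homotopic_with)
    show "(j South = South) = (k South = South)" if "\<And>x. x \<in> topspace ?S \<Longrightarrow> j x = k x" for j k
      using that[OF South] by simp
    have "h (t, South) = South" if "0 \<le> t" "t \<le> 1" for t
      using ht[OF that b] South_iff[OF b] bS FA[OF that in_Z[OF b]] by auto
    moreover have "h (0, y) = suspension_map (card V + 1) f y" "h (1, y) = South" if "y \<in> topspace ?S" for y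
      using surj[OF that] ht[of 0] ht[of 1] P by (auto simp: F0 F1)
    ultimately show "\<exists>h. continuous_map (prod_topology ?I ?S) W h \<and>
        (\<forall>x\<in>topspace ?S. h (0, x) = suspension_map (card V + 1) f x) \<and>
        (\<forall>x\<in>topspace ?S. h (1, x) = South) \<and> (\<forall>t\<in>{0..1}. h (t, South) = South)"
      using h by (intro exI[of _ h]) auto
  qed
qed

end


subsection \<open>Co-H-spaces and the join\<close>

lemma mem_simplicial_join_full_subcomplex_iff:
  assumes "I \<inter> J = {}"
  shows "\<sigma> \<in> simplicial_join (full_subcomplex K I) (full_subcomplex K J) \<longleftrightarrow>
    \<sigma> \<subseteq> I \<union> J \<and> \<sigma> \<inter> I \<in> K \<and> \<sigma> \<inter> J \<in> K"
proof
  assume "\<sigma> \<in> simplicial_join (full_subcomplex K I) (full_subcomplex K J)"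
  then obtain \<alpha> \<beta> where *: "\<sigma> = \<alpha> \<union> \<beta>" "\<alpha> \<in> K" "\<alpha> \<subseteq> I" "\<beta> \<in> K" "\<beta> \<subseteq> J"
    by (auto simp: simplicial_join_def full_subcomplex_def)
  then have "\<sigma> \<inter> I = \<alpha>" "\<sigma> \<inter> J = \<beta>" using assms by auto
  with * show "\<sigma> \<subseteq> I \<union> J \<and> \<sigma> \<inter> I \<in> K \<and> \<sigma> \<inter> J \<in> K" by auto
next
  assume "\<sigma> \<subseteq> I \<union> J \<and> \<sigma> \<inter> I \<in> K \<and> \<sigma> \<inter> J \<in> K"
  then show "\<sigma> \<in> simplicial_join (full_subcomplex K I) (full_subcomplex K J)"
    unfolding simplicial_join_def full_subcomplex_def
    by (intro CollectI exI[of _ "\<sigma> \<inter> I"] exI[of _ "\<sigma> \<inter> J"]) auto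
qed

lemma topspace_realization_mono: "K \<subseteq> L \<Longrightarrow> topspace (realization K) \<subseteq> topspace (realization L)"
  by (auto simp: realization_def)

text \<open>A face of the join is tested separately on \<open>I\<close> and on \<open>J\<close>, so
  two points may be spliced even when their union of supports is not a face of
  \<open>K\<close>.\<close>

lemma combine_mem_moment_angle_join:
  assumes "simplicial_complex_on V K" "I \<inter> J = {}"
    and z: "z \<in> topspace (moment_angle V K)" and z': "z' \<in> topspace (moment_angle V K)"
    and "I \<subseteq> V" "J \<subseteq> V"
    and L: "simplicial_complex_on (I \<union> J) (simplicial_join (full_subcomplex K I) (full_subcomplex K J))"
  shows "(\<lambda>i\<in>I \<union> J. if i \<in> I then z i else z' i)
     \<in> topspace (moment_angle (I \<union> J) (simplicial_join (full_subcomplex K I) (full_subcomplex K J)))"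
proof -
  let ?u = "\<lambda>i\<in>I \<union> J. if i \<in> I then z i else z' i"
  let ?N = "{i \<in> I \<union> J. norm (?u i) \<noteq> 1}"
  note Z = topspace_moment_angle[OF assms(1)]
  have "?N \<inter> I \<subseteq> {i \<in> V. norm (z i) \<noteq> 1}" "?N \<inter> J \<subseteq> {i \<in> V. norm (z' i) \<noteq> 1}"
    using assms(2,5,6) by (auto split: if_splits)
  then have "?N \<inter> I \<in> K" "?N \<inter> J \<in> K"
    using z z' assms(1) unfolding Z simplicial_complex_on_def by blast+
  then have "?N \<in> simplicial_join (full_subcomplex K I) (full_subcomplex K J)"
    unfolding mem_simplicial_join_full_subcomplex_iff[OF assms(2)] by blast
  moreover have "\<forall>i\<in>I \<union> J. norm (?u i) \<le> 1" using z z' assms(5,6) unfolding Z by auto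
  ultimately show ?thesis unfolding topspace_moment_angle[OF L] by auto
qed

theorem proposition3p5:
  fixes n :: nat and K :: "nat set set"
  assumes "simplicial_complex_on {1..n} K"
    and "no_ghost_vertices {1..n} K"
    and "co_H_space (moment_angle_complex n K) (moment_angle_base n)"
  shows "\<forall>I J. I \<subset> {1..n} \<and> J \<subset> {1..n} \<and> I \<noteq> {} \<and> J \<noteq> {} \<and> I \<inter> J = {} \<longrightarrow>
    nullhomotopic
      (suspension (card (I \<union> J) + 1) (realization (full_subcomplex K (I \<union> J)))) South
      (suspension (card (I \<union> J) + 1)
        (realization (simplicial_join (full_subcomplex K I) (full_subcomplex K J)))) South
      (suspension_map (card (I \<union> J) + 1) (realization_map id))"
proof (intro allI impI, elim conjE)
  fix I J :: "nat set"
  assume I: "I \<subset> {1..n}" "I \<noteq> {}" and J: "J \<subset> {1..n}" "J \<noteq> {}" and IJ: "I \<inter> J = {}"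
  define V where "V = I \<union> J"
  define M where "M = full_subcomplex K V"
  define L where "L = simplicial_join (full_subcomplex K I) (full_subcomplex K J)"
  note K = assms(1)
  have V: "V \<subseteq> {1..n}" "finite V" "V \<noteq> {}"
    using I J finite_subset[of V "{1..n}"] by (auto simp: V_def)
  have M: "simplicial_complex_on V M"
    using K by (auto simp: M_def full_subcomplex_def simplicial_complex_on_def)
  have L_iff: "\<sigma> \<in> L \<longleftrightarrow> \<sigma> \<subseteq> V \<and> \<sigma> \<inter> I \<in> K \<and> \<sigma> \<inter> J \<in> K" for \<sigma>
    unfolding L_def V_def by (rule mem_simplicial_join_full_subcomplex_iff[OF IJ])
  have L: "simplicial_complex_on V L"
    unfolding simplicial_complex_on_def
  proof (intro conjI ballI allI impI)
    fix \<sigma> \<tau> assume "\<sigma> \<in> L" "\<tau> \<subseteq> \<sigma>"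
    moreover have "\<tau> \<inter> I \<subseteq> \<sigma> \<inter> I" "\<tau> \<inter> J \<subseteq> \<sigma> \<inter> J" using \<open>\<tau> \<subseteq> \<sigma>\<close> by auto
    ultimately show "\<tau> \<in> L"
      using K unfolding L_iff simplicial_complex_on_def by (meson order_trans)
  qed (use K in \<open>auto simp: L_iff simplicial_complex_on_def\<close>)
  have sub: "M \<subseteq> L"
    using K unfolding M_def full_subcomplex_def simplicial_complex_on_def
    by (auto simp: L_iff)
  obtain v where v: "v \<in> V" using V by blast
  \<comment> \<open>Absence of ghost vertices makes both realisations non-empty, as the descriptions
    of the suspensions require.\<close>
  have "{v} \<in> M" using v V(1) assms(2) by (auto simp: M_def full_subcomplex_def no_ghost_vertices_def)
  then have "(\<lambda>i. if i = v then 1 else 0) \<in> topspace (realization M)"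
    using v V(2) unfolding topspace_realization[OF M V(2)] by auto
  then have ne: "topspace (realization M) \<noteq> {}" "topspace (realization L) \<noteq> {}"
    using topspace_realization_mono[OF sub] by auto
  define vs where "vs = sorted_list_of_set V"
  have vs: "distinct vs" "set vs = V" using V(2) by (auto simp: vs_def)
  let ?ZK = "moment_angle {1..n} K" and ?ZL = "moment_angle V L" and ?ZM = "moment_angle V M"
  let ?S = "suspension (card V + 1) (realization L)"
  obtain p where p: "continuous_map ?ZL ?S p"
    and pc: "\<And>a. a \<in> topspace (suspension_cylinder V (realization L)) \<Longrightarrow>
        p (cylinder_map V a) = suspension_class vs a"
    and p1: "\<And>z i. \<lbrakk>z \<in> topspace ?ZL; i \<in> V; z i = 1\<rbrakk> \<Longrightarrow> p z = South"
    using moment_angle_to_suspension[OF L V(2) vs ne(2)] by blast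
  have Zsub: "topspace ?ZM \<subseteq> topspace ?ZL"
    using sub by (auto simp: topspace_moment_angle[OF M] topspace_moment_angle[OF L])
  have csub: "continuous_map ?ZM ?ZL (\<lambda>z. z)"
    using Zsub by (intro continuous_map_into_moment_angle continuous_map_moment_angle_coord) auto
  have mac: "moment_angle_complex n K = ?ZK" by (simp add: moment_angle_complex_def moment_angle_def)
  let ?b = "moment_angle_base n"
  obtain \<psi> where \<psi>: "pointed_map ?ZK ?b (wedge ?ZK ?b ?ZK ?b) (?b, ?b) \<psi>"
    and \<psi>1: "pointed_homotopic ?ZK ?b ?ZK ?b (fst \<circ> \<psi>) id"
    and \<psi>2: "pointed_homotopic ?ZK ?b ?ZK ?b (snd \<circ> \<psi>) id"
    using assms(3) unfolding co_H_space_def mac by blast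
  obtain g where g: "continuous_map (prod_topology (top_of_set {0..1::real}) ?ZK) ?ZK g"
      "\<forall>z. g (0, z) = (fst \<circ> \<psi>) z" "\<forall>z. g (1, z) = id z"
    using \<psi>1 unfolding pointed_homotopic_def homotopic_with_def by blast
  obtain h where h: "continuous_map (prod_topology (top_of_set {0..1::real}) ?ZK) ?ZK h"
      "\<forall>z. h (0, z) = (snd \<circ> \<psi>) z" "\<forall>z. h (1, z) = id z"
    using \<psi>2 unfolding pointed_homotopic_def homotopic_with_def by blast
  \<comment> \<open>The inclusion of the moment-angle complex of \<open>M\<close>, with basepoint
    coordinates filled in outside \<open>V\<close>.\<close>
  define e where "e = (\<lambda>z. \<lambda>i\<in>{1..n}. if i \<in> V then z i else (1 :: complex))"
  have e: "continuous_map ?ZM ?ZK e"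
  proof (rule continuous_map_into_moment_angle)
    show "e z \<in> topspace ?ZK" if "z \<in> topspace ?ZM" for z
    proof -
      have "{i \<in> {1..n}. norm (e z i) \<noteq> 1} = {i \<in> V. norm (z i) \<noteq> 1}"
        using V(1) by (auto simp: e_def split: if_splits)
      then show ?thesis
        using that unfolding topspace_moment_angle[OF K] topspace_moment_angle[OF M]
        by (auto simp: M_def full_subcomplex_def) (auto simp: e_def)
    qed
    show "continuous_map ?ZM euclidean (\<lambda>z. e z i)" if "i \<in> {1..n}" for i
      using that by (cases "i \<in> V") (simp_all add: e_def continuous_map_moment_angle_coord)
  qed
  let ?X = "prod_topology (top_of_set {0..1::real}) ?ZM"
  have ce: "continuous_map ?X (prod_topology (top_of_set {0..1::real}) ?ZK) (\<lambda>q. (fst q, e (snd q)))"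
    using continuous_map_compose[OF continuous_map_snd e]
    by (intro continuous_map_pairedI continuous_map_fst) (simp add: o_def)
  define m where "m = (\<lambda>z z'. \<lambda>i\<in>V. if i \<in> I then z i else (z' i :: complex))"
  have m_in: "m z z' \<in> topspace ?ZL" if "z \<in> topspace ?ZK" "z' \<in> topspace ?ZK" for z z'
    using combine_mem_moment_angle_join[OF K IJ that] I(1) J(1) L unfolding m_def V_def L_def by blast
  have gh: "continuous_map ?X ?ZK (\<lambda>q. g (fst q, e (snd q)))" "continuous_map ?X ?ZK (\<lambda>q. h (fst q, e (snd q)))"
    using continuous_map_compose[OF ce g(1)] continuous_map_compose[OF ce h(1)] by (simp_all add: o_def)
  \<comment> \<open>The two counit homotopies run simultaneously, one seen on \<open>I\<close> and
    the other on \<open>J\<close>. The spliced point need not lie over \<open>M\<close>, but it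
    always lies over the join.\<close>
  have H: "continuous_map ?X ?ZL (\<lambda>q. m (g (fst q, e (snd q))) (h (fst q, e (snd q))))"
  proof (rule continuous_map_into_moment_angle)
    show "m (g (fst q, e (snd q))) (h (fst q, e (snd q))) \<in> topspace ?ZL" if "q \<in> topspace ?X" for q
      using gh that by (intro m_in) (auto simp: continuous_map_def Pi_iff)
    show "continuous_map ?X euclidean (\<lambda>q. m (g (fst q, e (snd q))) (h (fst q, e (snd q))) i)" if "i \<in> V" for i
    proof -
      have "i \<in> {1..n}" using that V(1) by auto
      from continuous_map_compose[OF gh(1) continuous_map_moment_angle_coord[OF this]]
        continuous_map_compose[OF gh(2) continuous_map_moment_angle_coord[OF this]]
      show ?thesis using that by (cases "i \<in> I") (simp_all add: m_def o_def)
    qed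
  qed
  \<comment> \<open>At time 0 the point \<psi> (\<open>e z\<close>) lies on one axis of the wedge,
    so all \<open>I\<close>-coordinates or all \<open>J\<close>-coordinates of the splice are 1. As
    \<open>I\<close> and \<open>J\<close> are non-empty, it lies in the fat wedge.\<close>
  have "p (m (g (0, e z)) (h (0, e z))) = South" if "z \<in> topspace ?ZM" for z
  proof -
    have ez: "e z \<in> topspace ?ZK" using e that by (auto simp: continuous_map_def)
    then have "\<psi> (e z) \<in> topspace (wedge ?ZK ?b ?ZK ?b)"
      using \<psi> by (auto simp: pointed_map_def continuous_map_def)
    then have w: "fst (\<psi> (e z)) \<in> topspace ?ZK" "snd (\<psi> (e z)) \<in> topspace ?ZK"
      "fst (\<psi> (e z)) = ?b \<or> snd (\<psi> (e z)) = ?b"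
      by (auto simp: wedge_def)
    obtain i j where "i \<in> I" "j \<in> J" using I J by blast
    then have ij: "i \<in> I" "j \<in> J" "j \<notin> I" "i \<in> V" "j \<in> V" "i \<in> {1..n}" "j \<in> {1..n}"
      using I J IJ by (auto simp: V_def)
    from w(3) show ?thesis
    proof
      assume "fst (\<psi> (e z)) = ?b"
      then have "m (g (0, e z)) (h (0, e z)) i = 1"
        using ij by (simp add: m_def g moment_angle_base_def)
      then show ?thesis using p1 m_in[OF w(1,2)] ij by (simp add: g h)
    next
      assume "snd (\<psi> (e z)) = ?b"
      then have "m (g (0, e z)) (h (0, e z)) j = 1"
        using ij by (simp add: m_def h moment_angle_base_def)
      then show ?thesis using p1 m_in[OF w(1,2)] ij by (simp add: g h)
    qed
  qed
  moreover have "m (e z) (e z) = z" if "z \<in> topspace ?ZM" for z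
    using that V(1) by (auto simp: topspace_moment_angle[OF M] m_def e_def extensional_def fun_eq_iff)
  \<comment> \<open>At time 1 both homotopies are the identity and the splice returns
    \<open>z\<close>. This homotopy is free; \<open>nullhomotopic_suspension_map\<close> supplies
    the control on the fat wedge.\<close>
  ultimately have "homotopic_with (\<lambda>_. True) ?ZM ?S (\<lambda>_. South) p"
    using continuous_map_compose[OF H p]
    by (subst homotopic_with)
      (auto simp: g(3) h(3) o_def intro!: exI[of _ "\<lambda>q. p (m (g (fst q, e (snd q))) (h (fst q, e (snd q))))"])
  then have hom: "homotopic_with (\<lambda>_. True) ?ZM ?S p (\<lambda>_. South)"
    by (rule homotopic_with_sym[THEN iffD1])
  have "nullhomotopic (suspension (card V + 1) (realization M)) South ?S South
     (suspension_map (card V + 1) (realization_map id))"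
  proof (rule nullhomotopic_suspension_map[OF M V(2) vs ne(1) _ _ hom])
    show "p z = South" if "z \<in> topspace ?ZM" "i \<in> V" "z i = 1" for z i
      using that Zsub p1 by blast
    fix a assume a: "a \<in> topspace (suspension_cylinder V (realization M))"
    obtain x s t where [simp]: "a = ((x, s), t)" by (metis prod.collapse)
    \<comment> \<open>Naturality: \<open>cylinder_map V\<close> and \<open>suspension_class\<close>
      do not refer to the complex, so the formula for \<open>p\<close> over \<open>L\<close> applies
      verbatim to points over \<open>M\<close>.\<close>
    have "a \<in> topspace (suspension_cylinder V (realization L))"
      using a topspace_realization_mono[OF sub] by (auto simp: topspace_suspension_cylinder)
    then show "p (cylinder_map V a) = suspension_map (card V + 1) (realization_map id) (suspension_class vs a)"
      using suspension_map_class[of vs "realization_map id" x s t] vs distinct_card[OF vs(1)]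
      by (simp add: pc realization_map_id)
  qed
  then show "nullhomotopic
      (suspension (card (I \<union> J) + 1) (realization (full_subcomplex K (I \<union> J)))) South
      (suspension (card (I \<union> J) + 1)
        (realization (simplicial_join (full_subcomplex K I) (full_subcomplex K J)))) South
      (suspension_map (card (I \<union> J) + 1) (realization_map id))"
    by (simp add: V_def M_def L_def)
qed

end
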